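(* Let $n\in\mathbb{N}_0=\{0,1,2,\dots\}$, $\nu\in\mathbb{R}$ and $\beta\in[0,1)$. The following statements hold. (a) If $\nu>n$, then the radius $r_\beta^c(f_{\nu,n})$ is the smallest positive root of the equation $$1-\beta+\frac{rJ_\nu^{(n+2)}(r)}{J_\nu^{(n+1)}(r)}+\left(\frac1{\nu-n}-1\right)\frac{rJ_\nu^{(n+1)}(r)}{J_\nu^{(n)}(r)}=0.$$ Moreover, $r_\beta^c(f_{\nu,n})<j_{\nu,1}^{(n+1)}<j_{\nu,1}^{(n)}$. (b) If $\nu>n-1$, then the radius $r_\beta^c(g_{\nu,n})$ is the smallest positive root of the equation $$n+1-\nu-\beta+\frac{(n-\nu+2)rJ_\nu^{(n+1)}(r)+r^2J_\nu^{(n+2)}(r)}{(n-\nu+1)J_\nu^{(n)}(r)+rJ_\nu^{(n+1)}(r)}=0.$$ (c) If $\nu>n-1$, then the radius $r_\beta^c(h_{\nu,n})$ is the smallest positive root of the equation $$\frac{n+2-\nu-2\beta}{2}+\frac{\sqrt r}{2}\cdot\frac{(n-\nu+3)J_\nu^{(n+1)}(\sqrt r)+\sqrt r\,J_\nu^{(n+2)}(\sqrt r)}{(n-\nu+2)J_\nu^{(n)}(\sqrt r)+\sqrt r\,J_\nu^{(n+1)}(\sqrt r)}=0.$$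
   Context: $J_\nu(z)=\sum_{m\ge 0}\frac{(-1)^m}{m!\,\Gamma(m+\nu+1)}\left(\frac z2\right)^{2m+\nu}$ is the Bessel function of the first kind of order $\nu$, $J_\nu^{(n)}$ is its $n$th derivative, and $j_{\nu,m}^{(n)}$ is the $m$th positive zero of $J_\nu^{(n)}$. For $\nu>n-1$ (and $\nu\neq n$ for $f_{\nu,n}$) define the normalized functions $$f_{\nu,n}(z)=\left[2^\nu\Gamma(\nu-n+1)J_\nu^{(n)}(z)\right]^{\frac1{\nu-n}},\quad g_{\nu,n}(z)=2^\nu\Gamma(\nu-n+1)z^{1+n-\nu}J_\nu^{(n)}(z),\quad h_{\nu,n}(z)=2^\nu\Gamma(\nu-n+1)z^{1+\frac{n-\nu}2}J_\nu^{(n)}(\sqrt z).$$ Each is understood as the analytic function near $0$ with value $0$ and derivative $1$ at $0$: one has $$2^\nu\Gamma(\nu-n+1)z^{n-\nu}J_\nu^{(n)}(z)=\sum_{m\ge0}\frac{(-1)^m\Gamma(2m+\nu+1)\Gamma(\nu-n+1)}{m!\,4^m\,\Gamma(2m-n+\nu+1)\Gamma(m+\nu+1)}z^{2m}=:E(z),$$ an even entire function with $E(0)=1$, and $g_{\nu,n}(z)=zE(z)$, $h_{\nu,n}(z)=zE(\sqrt z)$ (both entire), $f_{\nu,n}(z)=zE(z)^{1/(\nu-n)}$ with the branch equal to $1$ at $z=0$. For $f$ analytic near $0$ with $f(0)=0$, $f'(0)=1$, and with $r_f$ the radius of convergence of its power series at $0$, the radius of convexity of order $\beta\in[0,1)$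 is $$r_\beta^c(f)=\sup\left\{r\in(0,r_f):\ \mathrm{Re}\left(1+\frac{zf''(z)}{f'(z)}\right)>\beta\ \text{for all } z\in\mathbb{D}_r\right\},\qquad \mathbb{D}_r=\{z\in\mathbb{C}:|z|<r\}.$$ *)

theory Defs
  imports "HOL-Complex_Analysis.Complex_Analysis"
begin

(* Principal branch. HOL has 0 powr 0 = 0, so the value at z = 0 is not meaningful;
   the function and its derivatives are only used off the origin. If m + \<nu> + 1 is a
   nonpositive integer, Gamma and the whole summand are 0 in HOL, as they should be. *)
definition bessel_J :: "real \<Rightarrow> complex \<Rightarrow> complex" where
  "bessel_J \<nu> z =
     (\<Sum>m. of_real ((-1) ^ m / (fact m * Gamma (real m + \<nu> + 1)))
            * (z / 2) powr of_real (2 * real m + \<nu>))"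

definition bessel_J_deriv :: "real \<Rightarrow> nat \<Rightarrow> complex \<Rightarrow> complex" where
  "bessel_J_deriv \<nu> n = (deriv ^^ n) (bessel_J \<nu>)"

(* The m-th positive zero of the n-th derivative, for m > 0. *)
definition bessel_zero :: "real \<Rightarrow> nat \<Rightarrow> nat \<Rightarrow> real" where
  "bessel_zero \<nu> n m =
     (THE x. 0 < x \<and> bessel_J_deriv \<nu> n (of_real x) = 0 \<and>
             card {y. 0 < y \<and> y \<le> x \<and> bessel_J_deriv \<nu> n (of_real y) = 0} = m)"

(* The even entire continuation of 2^\<nu> Gamma(\<nu>-n+1) z^(n-\<nu>) J_\<nu>^(n)(z);
   see normalized_bessel_eq below. *)
definition normalized_bessel :: "real \<Rightarrow> nat \<Rightarrow> complex \<Rightarrow> complex" where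
  "normalized_bessel \<nu> n z =
     (\<Sum>m. of_real ((-1) ^ m * Gamma (2 * real m + \<nu> + 1) * Gamma (\<nu> - real n + 1)
              / (fact m * 4 ^ m * Gamma (2 * real m - real n + \<nu> + 1) * Gamma (real m + \<nu> + 1)))
            * z ^ (2 * m))"

(* Write E = normalized_bessel \<nu> n. The principal power is the branch of E(z)^(1/(\<nu>-n)) that is 1 at z = 0 only as long as
   E(z) stays off the negative axis, i.e. near 0. Beyond that, convexity_radius uses the
   sum of the power series at 0. *)
definition bessel_f :: "real \<Rightarrow> nat \<Rightarrow> complex \<Rightarrow> complex" where
  "bessel_f \<nu> n z = z * normalized_bessel \<nu> n z powr of_real (1 / (\<nu> - real n))"

definition bessel_g :: "real \<Rightarrow> nat \<Rightarrow> complex \<Rightarrow> complex" where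
  "bessel_g \<nu> n z = z * normalized_bessel \<nu> n z"

definition bessel_h :: "real \<Rightarrow> nat \<Rightarrow> complex \<Rightarrow> complex" where
  "bessel_h \<nu> n z = z * normalized_bessel \<nu> n (csqrt z)"

(* The function is given by its germ at 0: on discs inside the disc of convergence it is read
   as the sum of its Taylor series. The condition deriv \<phi> z \<noteq> 0 makes the quotient defined
   (HOL has x / 0 = 0). *)
definition convexity_radius :: "real \<Rightarrow> (complex \<Rightarrow> complex) \<Rightarrow> ereal" where
  "convexity_radius \<beta> f =
     (let F = fps_expansion f 0; \<phi> = eval_fps F
      in Sup {ereal r | r. 0 < r \<and> ereal r < fps_conv_radius F \<and>
                (\<forall>z\<in>ball 0 r. deriv \<phi> z \<noteq> 0 \<and>
                   Re (1 + z * deriv (deriv \<phi>) z / deriv \<phi> z) > \<beta>)})"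

definition smallest_positive_root :: "(real \<Rightarrow> bool) \<Rightarrow> real \<Rightarrow> bool" where
  "smallest_positive_root P r \<longleftrightarrow> 0 < r \<and> P r \<and> (\<forall>s. 0 < s \<and> P s \<longrightarrow> r \<le> s)"


text \<open>Agreement of the series with the formula in terms of the derivatives of the
  Bessel function.\<close>

definition bessel_fps :: "real \<Rightarrow> nat \<Rightarrow> complex fps" where
  "bessel_fps \<nu> n = Abs_fps (\<lambda>m. of_real ((-1) ^ m * (\<Prod>i<n. 2 * real m + \<nu> - real i)
                        / (fact m * 4 ^ m * 2 powr \<nu> * Gamma (real m + \<nu> + 1))))"

lemma bessel_fps_Suc:
  "bessel_fps \<nu> (Suc n) = fps_const (of_real (\<nu> - real n)) * bessel_fps \<nu> n
     + 2 * fps_X * fps_deriv (bessel_fps \<nu> n)"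
proof (rule fps_ext)
  fix m
  have "fps_nth (bessel_fps \<nu> (Suc n)) m = of_real (2 * real m + \<nu> - real n) * fps_nth (bessel_fps \<nu> n) m"
    unfolding bessel_fps_def fps_nth_Abs_fps of_real_mult[symmetric] by (simp add: mult_ac)
  moreover have "fps_nth (2 * fps_X * fps_deriv (bessel_fps \<nu> n)) m = 2 * of_nat m * fps_nth (bessel_fps \<nu> n) m"
    by (cases m) (simp_all add: mult.assoc numeral_fps_const)
  ultimately show "fps_nth (bessel_fps \<nu> (Suc n)) m = fps_nth (fps_const (of_real (\<nu> - real n)) * bessel_fps \<nu> n
     + 2 * fps_X * fps_deriv (bessel_fps \<nu> n)) m"
    by (simp add: algebra_simps)
qed

lemma bessel_fps_conv_radius:
  assumes "\<nu> > -1"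
  shows "fps_conv_radius (bessel_fps \<nu> n) = \<infinity>"
proof (induction n)
  case 0
  have nz: "Gamma (real m + \<nu> + 1) > 0" for m
    using assms by (intro Gamma_real_pos) linarith
  have eq: "norm (fps_nth (bessel_fps \<nu> 0) m) / norm (fps_nth (bessel_fps \<nu> 0) (Suc m))
      = 4 * (real m + 1) * (real m + \<nu> + 1)" for m
  proof -
    have "real m + \<nu> + 1 > 0" using assms by linarith
    hence "real m + \<nu> + 1 \<notin> \<int>\<^sub>\<le>\<^sub>0" by (auto elim!: nonpos_Ints_cases)
    from Gamma_plus1[OF this]
    have "Gamma (real (Suc m) + \<nu> + 1) = (real m + \<nu> + 1) * Gamma (real m + \<nu> + 1)"
      by (simp add: add_ac)
    moreover have norm_eq: "norm (fps_nth (bessel_fps \<nu> 0) k) = 1 / (fact k * 4 ^ k * 2 powr \<nu> * Gamma (real k + \<nu> + 1))" for k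
      unfolding bessel_fps_def fps_nth_Abs_fps norm_of_real using nz[of k]
      by (simp add: abs_mult power_abs)
    ultimately show ?thesis using less_imp_neq[OF nz[of m]] \<open>real m + \<nu> + 1 > 0\<close>
      unfolding norm_eq by (simp add: divide_simps add_ac) (simp add: algebra_simps)
  qed
  have "filterlim (\<lambda>m. 4 * (real m + 1) * (real m + \<nu> + 1)) at_top sequentially"
    by real_asymp
  hence "(\<lambda>m. ereal (4 * (real m + 1) * (real m + \<nu> + 1))) \<longlonglongrightarrow> \<infinity>"
    by (simp add: tendsto_PInfty_eq_at_top)
  thus ?case unfolding fps_conv_radius_def
    by (intro conv_radius_ratio_limit_ereal_nonzero) (simp_all only: eq, auto)
next
  case (Suc n)
  have "fps_conv_radius (fps_deriv (bessel_fps \<nu> n)) = \<infinity>"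
    using fps_conv_radius_deriv[of "bessel_fps \<nu> n"] Suc by simp
  hence "fps_conv_radius (2 * fps_X * fps_deriv (bessel_fps \<nu> n)) \<ge> \<infinity>"
    by (intro fps_conv_radius_mult_ge) auto
  moreover have "fps_conv_radius (fps_const (of_real (\<nu> - real n)) * bessel_fps \<nu> n) \<ge> \<infinity>"
    using Suc by (intro fps_conv_radius_mult_ge) auto
  ultimately have "fps_conv_radius (bessel_fps \<nu> (Suc n)) \<ge> \<infinity>"
    unfolding bessel_fps_Suc by (intro fps_conv_radius_add_ge)
  thus ?case by simp
qed

lemma bessel_J_eq_fps:
  assumes "\<nu> > -1" "z \<noteq> 0"
  shows "bessel_J \<nu> z = z powr of_real \<nu> * eval_fps (bessel_fps \<nu> 0) (z ^ 2)"
proof -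
  have *: "(z / 2) powr of_real (2 * real m + \<nu>)
      = z powr of_real \<nu> * (of_real (1 / (2 powr \<nu> * 4 ^ m)) * (z ^ 2) ^ m)" for m
  proof -
    have "(z / 2) powr of_real (2 * real m + \<nu>) = (z / 2) powr of_nat (2 * m) * (z / 2) powr of_real \<nu>"
      by (simp add: powr_add)
    also have "(z / 2) powr of_nat (2 * m) = (z / 2) ^ (2 * m)"
      using assms by (subst powr_nat') auto
    also have "\<dots> = (z ^ 2) ^ m / 4 ^ m"
      by (simp add: power_divide power_mult)
    also have "(z / 2) powr of_real \<nu> = z powr of_real \<nu> / of_real (2 powr \<nu>)"
    proof -
      have "Ln (z / 2) = Ln z - of_real (ln 2)"
        using Ln_divide_of_real[of 2 z] assms by simp
      thus ?thesis using assms
        by (simp add: powr_def exp_diff ring_distribs exp_of_real[symmetric])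
    qed
    finally show ?thesis by (simp add: mult_ac)
  qed
  have "summable (\<lambda>m. fps_nth (bessel_fps \<nu> 0) m * (z ^ 2) ^ m)"
    using bessel_fps_conv_radius[OF assms(1), of 0] by (intro summable_fps) auto
  hence "z powr of_real \<nu> * eval_fps (bessel_fps \<nu> 0) (z ^ 2)
      = (\<Sum>m. z powr of_real \<nu> * (fps_nth (bessel_fps \<nu> 0) m * (z ^ 2) ^ m))"
    by (simp add: eval_fps_def suminf_mult)
  also have "\<dots> = bessel_J \<nu> z"
    unfolding bessel_J_def * by (simp add: bessel_fps_def field_simps)
  finally show ?thesis ..
qed

lemma bessel_J_deriv_eq_fps:
  assumes "\<nu> > -1" "z \<notin> \<real>\<^sub>\<le>\<^sub>0"
  shows "bessel_J_deriv \<nu> n z = z powr of_real (\<nu> - real n) * eval_fps (bessel_fps \<nu> n) (z ^ 2)"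
  using assms(2)
proof (induction n arbitrary: z)
  case 0
  hence "z \<noteq> 0" by auto
  thus ?case using bessel_J_eq_fps[OF assms(1), of z] by (simp add: bessel_J_deriv_def)
next
  case (Suc n)
  define A where "A = bessel_fps \<nu> n"
  define s where "s = complex_of_real (\<nu> - real n)"
  have [simp]: "fps_conv_radius A = \<infinity>"
    using bessel_fps_conv_radius[OF assms(1)] by (simp add: A_def)
  have [simp]: "fps_conv_radius (fps_deriv A) = \<infinity>"
    using fps_conv_radius_deriv[of A] by simp
  have z: "z \<noteq> 0" using Suc.prems by auto
  have "eventually (\<lambda>w. w \<in> - \<real>\<^sub>\<le>\<^sub>0) (nhds z)"
    using Suc.prems by (intro eventually_nhds_in_open) auto
  hence ev: "eventually (\<lambda>w. bessel_J_deriv \<nu> n w = w powr s * eval_fps A (w ^ 2)) (nhds z)"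
    by eventually_elim (use Suc.IH in \<open>auto simp: s_def A_def\<close>)
  have D2: "((\<lambda>w. eval_fps A (w ^ 2)) has_field_derivative eval_fps (fps_deriv A) (z ^ 2) * (2 * z)) (at z)"
    by (rule DERIV_chain2[OF has_field_derivative_eval_fps])
       (auto intro!: derivative_eq_intros)
  have "((\<lambda>w. w powr s * eval_fps A (w ^ 2)) has_field_derivative
     (s * z powr (s - 1) * eval_fps A (z ^ 2) + eval_fps (fps_deriv A) (z ^ 2) * (2 * z) * z powr s)) (at z)"
    by (rule DERIV_mult[OF has_field_derivative_powr D2]) (use Suc.prems in auto)
  hence "deriv (\<lambda>w. w powr s * eval_fps A (w ^ 2)) z =
     s * z powr (s - 1) * eval_fps A (z ^ 2) + eval_fps (fps_deriv A) (z ^ 2) * (2 * z) * z powr s"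
    by (rule DERIV_imp_deriv)
  moreover have "z powr s = z powr (s - 1) * z"
    using z by (simp add: powr_diff)
  ultimately have "deriv (\<lambda>w. w powr s * eval_fps A (w ^ 2)) z =
     z powr (s - 1) * (s * eval_fps A (z ^ 2) + 2 * z ^ 2 * eval_fps (fps_deriv A) (z ^ 2))"
    by (simp add: algebra_simps power2_eq_square)
  also have "s * eval_fps A (z ^ 2) + 2 * z ^ 2 * eval_fps (fps_deriv A) (z ^ 2)
      = eval_fps (fps_const s * A + 2 * fps_X * fps_deriv A) (z ^ 2)"
  proof -
    have 1: "fps_conv_radius (2 * fps_X :: complex fps) = \<infinity>"
      using fps_conv_radius_mult[of "2 :: complex fps" fps_X] by simp
    have 2: "fps_conv_radius (2 * fps_X * fps_deriv A) = \<infinity>"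
      using fps_conv_radius_mult[of "2 * fps_X" "fps_deriv A"] 1 by simp
    have 3: "fps_conv_radius (fps_const s * A) = \<infinity>"
      using fps_conv_radius_mult[of "fps_const s" A] by simp
    show ?thesis using 1 2 3 by (simp add: eval_fps_add eval_fps_mult)
  qed
  also have "deriv (\<lambda>w. w powr s * eval_fps A (w ^ 2)) z = bessel_J_deriv \<nu> (Suc n) z"
    using deriv_cong_ev[OF ev refl] by (simp add: bessel_J_deriv_def)
  finally show ?case
    by (simp add: bessel_fps_Suc A_def s_def algebra_simps)
qed

lemma normalized_bessel_eq:
  assumes "\<nu> > real n - 1" "z \<notin> \<real>\<^sub>\<le>\<^sub>0"
  shows "normalized_bessel \<nu> n z =
           of_real (2 powr \<nu> * Gamma (\<nu> - real n + 1)) * z powr of_real (real n - \<nu>) * bessel_J_deriv \<nu> n z"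
proof -
  have \<nu>: "\<nu> > -1" using assms(1) by simp
  have z: "z \<noteq> 0" using assms(2) by auto
  have G: "Gamma (2 * real m + \<nu> + 1) = (\<Prod>i<k. 2 * real m + \<nu> - real i) * Gamma (2 * real m - real k + \<nu> + 1)"
    if "k \<le> n" for m k
    using that
  proof (induction k)
    case (Suc k)
    have "2 * real m + \<nu> - real k > 0" using Suc.prems assms(1) by linarith
    hence "2 * real m + \<nu> - real k \<notin> \<int>\<^sub>\<le>\<^sub>0" by (auto elim!: nonpos_Ints_cases)
    from Gamma_plus1[OF this]
    have "Gamma (2 * real m - real k + \<nu> + 1) = (2 * real m + \<nu> - real k) * Gamma (2 * real m - real (Suc k) + \<nu> + 1)"
      by (simp add: algebra_simps)
    with Suc show ?case by simp
  qed auto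
  have pos: "Gamma (2 * real m - real n + \<nu> + 1) > 0" for m
    using assms(1) by (intro Gamma_real_pos) linarith
  have pos': "Gamma (real m + \<nu> + 1) > 0" for m
    using \<nu> by (intro Gamma_real_pos) linarith
  have *: "of_real ((-1) ^ m * Gamma (2 * real m + \<nu> + 1) * Gamma (\<nu> - real n + 1)
              / (fact m * 4 ^ m * Gamma (2 * real m - real n + \<nu> + 1) * Gamma (real m + \<nu> + 1))) * z ^ (2 * m)
      = of_real (2 powr \<nu> * Gamma (\<nu> - real n + 1)) * (fps_nth (bessel_fps \<nu> n) m * (z ^ 2) ^ m)" for m
  proof -
    have eq: "(-1) ^ m * Gamma (2 * real m + \<nu> + 1) * Gamma (\<nu> - real n + 1)
              / (fact m * 4 ^ m * Gamma (2 * real m - real n + \<nu> + 1) * Gamma (real m + \<nu> + 1))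
      = 2 powr \<nu> * Gamma (\<nu> - real n + 1) * ((-1) ^ m * (\<Prod>i<n. 2 * real m + \<nu> - real i)
                        / (fact m * 4 ^ m * 2 powr \<nu> * Gamma (real m + \<nu> + 1)))"
      unfolding G[OF order_refl] using pos[of m] pos'[of m] by (simp add: field_simps)
    show ?thesis
      unfolding eq bessel_fps_def fps_nth_Abs_fps of_real_mult power_mult by (simp only: mult_ac)
  qed
  have "summable (\<lambda>m. fps_nth (bessel_fps \<nu> n) m * (z ^ 2) ^ m)"
    using bessel_fps_conv_radius[OF \<nu>, of n] by (intro summable_fps) auto
  hence "normalized_bessel \<nu> n z
      = of_real (2 powr \<nu> * Gamma (\<nu> - real n + 1)) * eval_fps (bessel_fps \<nu> n) (z ^ 2)"
    unfolding normalized_bessel_def * eval_fps_def by (rule suminf_mult)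
  also have "eval_fps (bessel_fps \<nu> n) (z ^ 2) = z powr of_real (real n - \<nu>) * bessel_J_deriv \<nu> n z"
  proof -
    have "z powr of_real (real n - \<nu>) * z powr of_real (\<nu> - real n) = 1"
      using z by (simp add: powr_def exp_add[symmetric] ring_distribs[symmetric])
    thus ?thesis
      by (simp add: bessel_J_deriv_eq_fps[OF \<nu> assms(2)] mult.assoc[symmetric])
  qed
  finally show ?thesis by (simp only: mult.assoc)
qed

end

theory Submission
  imports Defs
begin

text \<open>
  Write \<open>J\<^sup>(\<^sup>n\<^sup>)(z) = z\<^sup>\<nu>\<^sup>-\<^sup>n B(z\<^sup>2)\<close> and \<open>S = - B'/B\<close>. For \<open>n = 0\<close> the Bessel equation becomes the
  Riccati equation \<open>4wS' + 4(\<nu>+1)S = 1 + 4wS\<^sup>2\<close>, whose coefficient recursion shows that all Taylor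
  coefficients of \<open>S\<close> (the Rayleigh sums) are positive and grow at least geometrically. Passing from
  \<open>n\<close> to \<open>n + 1\<close>, or from \<open>g\<close> and \<open>h\<close> to their derivatives, replaces \<open>B\<close> by
  \<open>cB + 2wB' = B(c - T)\<close> with \<open>c > 0\<close> and \<open>T = 2wS\<close>, which adds \<open>T'/(c - T)\<close> to \<open>S\<close>; this series
  again has nonnegative coefficients. So neither the reality nor the interlacing of the zeros is needed.

  In all three cases \<open>1 + zf''/f' = 1 - a w K(w)\<close>, with \<open>w = z\<^sup>2\<close> and \<open>a = 2\<close> for \<open>f\<close> and \<open>g\<close>,
  and \<open>w = z\<close> and \<open>a = 1\<close> for \<open>h\<close>, where \<open>K\<close> has nonnegative coefficients; hence on each circle the
  real part is minimal at the positive real point, where it decreases from 1 to \<open>-\<infinity>\<close> before the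
  first singularity. For \<open>f\<close> one has \<open>K = (S\<^sub>n\<^sub>+\<^sub>1 - S\<^sub>n) + \<alpha> S\<^sub>n\<close> with \<open>\<alpha> = 1/(\<nu> - n)\<close>.
\<close>

subsection \<open>Logarithmic derivatives with nonnegative coefficients\<close>

definition nonneg_fps :: "complex fps \<Rightarrow> bool" where
  "nonneg_fps F \<longleftrightarrow> (\<forall>k. fps_nth F k \<in> \<real>\<^sub>\<ge>\<^sub>0)"

lemma nonneg_Reals_sum_I:
  "(\<And>x. x \<in> A \<Longrightarrow> f x \<in> \<real>\<^sub>\<ge>\<^sub>0) \<Longrightarrow> sum f A \<in> (\<real>\<^sub>\<ge>\<^sub>0 :: 'a :: real_algebra_1 set)"
  by (induction A rule: infinite_finite_induct) auto

lemma nonneg_fps_add: "nonneg_fps F \<Longrightarrow> nonneg_fps G \<Longrightarrow> nonneg_fps (F + G)"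
  by (simp add: nonneg_fps_def)

lemma nonneg_fps_mult: "nonneg_fps F \<Longrightarrow> nonneg_fps G \<Longrightarrow> nonneg_fps (F * G)"
  by (simp add: nonneg_fps_def fps_mult_nth nonneg_Reals_sum_I)

lemma nonneg_fps_deriv: "nonneg_fps F \<Longrightarrow> nonneg_fps (fps_deriv F)"
  unfolding nonneg_fps_def fps_deriv_nth by (intro allI nonneg_Reals_mult_I) auto

lemma nonneg_fps_const: "0 \<le> c \<Longrightarrow> nonneg_fps (fps_const (of_real c))"
  by (simp add: nonneg_fps_def)

lemma nonneg_fps_X: "nonneg_fps fps_X"
  by (simp add: nonneg_fps_def fps_X_def)

text \<open>The inverse \<open>U\<close> satisfies \<open>c * U = 1 + T * U\<close>. As
  \<open>T\<close> has no constant term, coefficient \<open>k\<close> on the right involves only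
  earlier coefficients of \<open>U\<close>, so strong induction applies.\<close>

lemma nonneg_fps_inverse_diff:
  assumes c: "0 < c" and T: "nonneg_fps T" and T0: "fps_nth T 0 = 0"
  shows "nonneg_fps (inverse (fps_const (of_real c) - T))"
proof -
  define U where "U = inverse (fps_const (of_real c) - T)"
  have "(fps_const (of_real c) - T) * U = 1"
    unfolding U_def using c T0 by (intro inverse_mult_eq_1') simp
  hence U: "fps_const (of_real c) * U = 1 + T * U"
    by (simp add: algebra_simps)
  have "fps_nth U k \<in> \<real>\<^sub>\<ge>\<^sub>0" for k
  proof (induction k rule: less_induct)
    case (less k)
    have "fps_nth T i * fps_nth U (k - i) \<in> \<real>\<^sub>\<ge>\<^sub>0" if "i \<in> {0..k}" for i
    proof (cases "i = 0")
      case False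
      with that have "k - i < k" by auto
      thus ?thesis using less T by (simp add: nonneg_fps_def)
    qed (simp add: T0)
    hence "fps_nth (1 + T * U) k \<in> \<real>\<^sub>\<ge>\<^sub>0"
      unfolding fps_add_nth fps_mult_nth by (intro nonneg_Reals_add_I nonneg_Reals_sum_I) auto
    hence "of_real c * fps_nth U k \<in> \<real>\<^sub>\<ge>\<^sub>0"
      unfolding U[symmetric] by simp
    hence "of_real c * fps_nth U k / of_real c \<in> \<real>\<^sub>\<ge>\<^sub>0"
      using c by (intro nonneg_Reals_divide_I) auto
    thus ?case using c by simp
  qed
  thus ?thesis by (simp add: U_def nonneg_fps_def)
qed

text \<open>For a product of factors \<open>1 - w / a\<close> over the zeros \<open>a\<close>,
  coefficient \<open>k\<close> is the sum of the powers \<open>1 / a ^ (k + 1)\<close>. The sign is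
  chosen to make these power sums positive when the zeros are.\<close>

definition neg_logderiv :: "complex fps \<Rightarrow> complex fps" where
  "neg_logderiv P = - fps_deriv P * inverse P"

lemma neg_logderiv_mult_self:
  assumes "fps_nth P 0 \<noteq> 0"
  shows "neg_logderiv P * P = - fps_deriv P"
  using inverse_mult_eq_1[OF assms] by (simp add: neg_logderiv_def mult.assoc)

lemma neg_logderiv_eqI:
  assumes "fps_nth P 0 \<noteq> 0" "S * P = - fps_deriv P"
  shows "neg_logderiv P = S"
  using assms inverse_mult_eq_1'[OF assms(1)] 
  by (metis neg_logderiv_def mult.assoc mult.right_neutral)

text \<open>If \<open>F(z) = z powr s * P(z^2)\<close>, then
  \<open>z * F'(z) = z powr s * Q(z^2)\<close> with \<open>Q = bessel_op s P\<close>. So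
  \<open>c = \<nu> - n\<close> leads to the next derivative of the Bessel function,
  \<open>c = 1\<close> to the derivative of \<open>z * P(z^2)\<close>, and \<open>c = 2\<close> to
  twice the derivative of \<open>w * P(w)\<close>.\<close>

definition bessel_op :: "real \<Rightarrow> complex fps \<Rightarrow> complex fps" where
  "bessel_op c P = fps_const (of_real c) * P + 2 * fps_X * fps_deriv P"

lemma bessel_op_0: "fps_nth (bessel_op c P) 0 = of_real c * fps_nth P 0"
  by (simp add: bessel_op_def)

text \<open>The difference equals \<open>T' / (c - T)\<close> with \<open>T = 2 * w * S\<close>, a
  product of two series with nonnegative coefficients. Case \<open>f\<close> relies on the
  difference itself, because there \<open>S\<close> enters with the factor
  \<open>\<alpha> - 1\<close>, which can be negative.\<close>

lemma nonneg_neg_logderiv_bessel_op_diff: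
  assumes P0: "fps_nth P 0 \<noteq> 0" and c: "0 < c" and S: "nonneg_fps (neg_logderiv P)"
  shows "nonneg_fps (neg_logderiv (bessel_op c P) - neg_logderiv P)"
proof -
  define S' where "S' = neg_logderiv P"
  define T where "T = 2 * fps_X * S'"
  define D where "D = fps_const (of_real c) - T"
  have dP: "fps_deriv P = - (S' * P)"
    using neg_logderiv_mult_self[OF P0] by (simp add: S'_def)
  have T0: "fps_nth T 0 = 0" by (simp add: T_def)
  have "nonneg_fps 2"
    using nonneg_fps_const[of 2] by (simp only: numeral_fps_const of_real_numeral zero_le_numeral simp_thms)
  hence T: "nonneg_fps T"
    unfolding T_def S'_def by (intro nonneg_fps_mult nonneg_fps_X S)
  have op: "bessel_op c P = P * D"
    unfolding bessel_op_def D_def T_def dP by (simp add: algebra_simps)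
  have D0: "fps_nth D 0 \<noteq> 0" using c T0 by (simp add: D_def)
  have dD: "fps_deriv D = - fps_deriv T" by (simp add: D_def)
  have "neg_logderiv (bessel_op c P) = S' + fps_deriv T * inverse D"
  proof (rule neg_logderiv_eqI)
    show "fps_nth (bessel_op c P) 0 \<noteq> 0" using P0 c by (simp add: bessel_op_0)
    have "(S' + fps_deriv T * inverse D) * (P * D) = S' * P * D + fps_deriv T * P * (inverse D * D)"
      by (simp add: algebra_simps)
    also have "\<dots> = - fps_deriv (P * D)"
      using inverse_mult_eq_1[OF D0] by (simp add: dD dP algebra_simps)
    finally show "(S' + fps_deriv T * inverse D) * bessel_op c P = - fps_deriv (bessel_op c P)"
      by (simp add: op)
  qed
  moreover have "nonneg_fps (fps_deriv T * inverse D)"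
    unfolding D_def by (intro nonneg_fps_mult nonneg_fps_deriv nonneg_fps_inverse_diff c T T0)
  ultimately show ?thesis by (simp add: S'_def)
qed

text \<open>The geometric lower bound serves two purposes: it forces the radius of convergence of
  \<open>neg_logderiv P\<close> to be finite, and at \<open>k = 0\<close> it makes the constant
  coefficient strictly positive.\<close>

definition rayleigh_class :: "complex fps \<Rightarrow> bool" where
  "rayleigh_class P \<longleftrightarrow> fps_conv_radius P = \<infinity> \<and> fps_nth P 0 \<noteq> 0 \<and> nonneg_fps (neg_logderiv P) \<and>
     (\<exists>A>0. \<exists>q>0. \<forall>k. A * q ^ k \<le> Re (fps_nth (neg_logderiv P) k))"

lemma fps_conv_radius_bessel_op:
  assumes "fps_conv_radius P = \<infinity>"
  shows "fps_conv_radius (bessel_op c P) = \<infinity>"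
proof -
  have "fps_conv_radius (fps_deriv P) = \<infinity>"
    using fps_conv_radius_deriv[of P] assms by simp
  hence "fps_conv_radius (2 * fps_X * fps_deriv P) \<ge> \<infinity>"
    by (intro fps_conv_radius_mult_ge) auto
  moreover have "fps_conv_radius (fps_const (of_real c) * P) \<ge> \<infinity>"
    using assms by (intro fps_conv_radius_mult_ge) auto
  ultimately have "fps_conv_radius (bessel_op c P) \<ge> \<infinity>"
    unfolding bessel_op_def by (intro fps_conv_radius_add_ge)
  thus ?thesis by simp
qed

lemma eval_bessel_op:
  assumes "fps_conv_radius P = \<infinity>"
  shows "eval_fps (bessel_op c P) w = of_real c * eval_fps P w + 2 * w * eval_fps (fps_deriv P) w"
proof -
  have d: "fps_conv_radius (fps_deriv P) = \<infinity>"
    using fps_conv_radius_deriv[of P] assms by simp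
  have 1: "fps_conv_radius (2 * fps_X :: complex fps) = \<infinity>"
    using fps_conv_radius_mult[of "2 :: complex fps" fps_X] by simp
  have 2: "fps_conv_radius (2 * fps_X * fps_deriv P) = \<infinity>"
    using fps_conv_radius_mult[of "2 * fps_X" "fps_deriv P"] 1 d by simp
  have 3: "fps_conv_radius (fps_const (of_real c) * P) = \<infinity>"
    using fps_conv_radius_mult[of "fps_const (of_real c)" P] assms by simp
  show ?thesis using 1 2 3 d assms by (simp add: bessel_op_def eval_fps_add eval_fps_mult)
qed

text \<open>Coefficients of the negative logarithmic derivative can only grow under
  \<open>bessel_op\<close>, so the same \<open>A\<close> and \<open>q\<close> serve again.\<close>

lemma rayleigh_class_bessel_op:
  assumes "rayleigh_class P" "0 < c"
  shows "rayleigh_class (bessel_op c P)"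
proof -
  from assms(1) obtain A q where A: "A > 0" "q > 0" "\<And>k. A * q ^ k \<le> Re (fps_nth (neg_logderiv P) k)"
    and P: "fps_conv_radius P = \<infinity>" "fps_nth P 0 \<noteq> 0" "nonneg_fps (neg_logderiv P)"
    unfolding rayleigh_class_def by blast
  have D: "nonneg_fps (neg_logderiv (bessel_op c P) - neg_logderiv P)"
    by (intro nonneg_neg_logderiv_bessel_op_diff P assms)
  have "nonneg_fps (neg_logderiv (bessel_op c P))"
    using nonneg_fps_add[OF D P(3)] by simp
  moreover have "A * q ^ k \<le> Re (fps_nth (neg_logderiv (bessel_op c P)) k)" for k
    using D A(3)[of k] unfolding nonneg_fps_def complex_nonneg_Reals_iff
    by (auto intro: order_trans)
  ultimately show ?thesis
    unfolding rayleigh_class_def using A(1,2) P assms(2)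
    by (auto simp: bessel_op_0 fps_conv_radius_bessel_op)
qed

section \<open>The Bessel equation in the variable \<open>w = z^2\<close> and its Riccati
  form\<close>

lemma bessel_fps_0_ode:
  assumes "\<nu> > -1"
  defines "B \<equiv> bessel_fps \<nu> 0"
  shows "4 * fps_X * fps_deriv (fps_deriv B) + fps_const (of_real (4 * (\<nu> + 1))) * fps_deriv B + B = 0"
proof (rule fps_ext)
  fix m
  define G where "G = Gamma (real m + \<nu> + 1)"
  define b where "b k = (- 1) ^ k / (fact k * 4 ^ k * 2 powr \<nu> * Gamma (real k + \<nu> + 1))" for k
  have B: "fps_nth B k = of_real (b k)" for k
    by (simp add: B_def bessel_fps_def b_def)
  have pos: "real m + \<nu> + 1 > 0" using assms by linarith
  hence "real m + \<nu> + 1 \<notin> \<int>\<^sub>\<le>\<^sub>0" by (auto elim!: nonpos_Ints_cases)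
  from Gamma_plus1[OF this] have G: "Gamma (real (Suc m) + \<nu> + 1) = (real m + \<nu> + 1) * G"
    by (simp add: add_ac G_def)
  have Gp: "G > 0" unfolding G_def using pos by (rule Gamma_real_pos)
  have "4 * (real m + 1) * (real m + \<nu> + 1) * b (Suc m) + b m = 0"
    unfolding b_def G G_def[symmetric] using pos Gp by (simp add: divide_simps)
  hence "of_real (4 * (real m + 1) * (real m + \<nu> + 1) * b (Suc m) + b m) = (0 :: complex)"
    by simp
  hence "complex_of_real (4 * (real m + 1) * (real m + \<nu> + 1)) * fps_nth B (Suc m) + fps_nth B m = 0"
    by (simp add: B)
  moreover have "fps_nth (4 * fps_X * fps_deriv (fps_deriv B)) m = 4 * of_nat m * (of_nat m + 1) * fps_nth B (Suc m)"
    by (cases m) (simp_all add: mult.assoc numeral_fps_const algebra_simps)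
  ultimately show "fps_nth (4 * fps_X * fps_deriv (fps_deriv B) + fps_const (of_real (4 * (\<nu> + 1))) * fps_deriv B + B) m
     = fps_nth 0 m"
    by (simp add: algebra_simps)
qed

text \<open>Insert \<open>B' = - S * B\<close> and \<open>B'' = (S * S - S') * B\<close> into the
  linear equation. The factor \<open>B\<close> then cancels because formal power series over a field
  form an integral domain.\<close>

lemma neg_logderiv_bessel_fps_0_riccati:
  assumes "\<nu> > -1"
  defines "S \<equiv> neg_logderiv (bessel_fps \<nu> 0)"
  shows "4 * fps_X * fps_deriv S + fps_const (of_real (4 * (\<nu> + 1))) * S = 1 + 4 * fps_X * (S * S)"
proof -
  define B where "B = bessel_fps \<nu> 0"
  define d where "d = fps_const (complex_of_real (4 * (\<nu> + 1)))"
  have "Gamma (\<nu> + 1) > 0" using assms by (intro Gamma_real_pos) auto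
  hence B0: "fps_nth B 0 \<noteq> 0" by (simp add: B_def bessel_fps_def)
  have dB: "fps_deriv B = - (S * B)"
    using neg_logderiv_mult_self[OF B0] by (simp add: S_def B_def)
  have "fps_deriv (fps_deriv B) = S * S * B - fps_deriv S * B"
    unfolding dB by (simp add: dB algebra_simps)
  with bessel_fps_0_ode[OF assms(1), folded B_def d_def]
  have "4 * fps_X * (S * S * B - fps_deriv S * B) + d * (- (S * B)) + B = 0"
    by (simp only: dB)
  hence "(1 + 4 * fps_X * (S * S) - (4 * fps_X * fps_deriv S + d * S)) * B = 0"
    by (simp add: algebra_simps)
  moreover have "B \<noteq> 0" using B0 by auto
  ultimately show ?thesis by (simp add: d_def)
qed

text \<open>Comparing coefficients in the Riccati equation expresses each coefficient of
  \<open>S\<close> as a convolution of earlier ones divided by the positive number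
  \<open>k + \<nu> + 1\<close>. Reality, positivity and the lower bound follow together by strong
  induction.\<close>

lemma rayleigh_class_bessel_fps_0:
  assumes "\<nu> > -1"
  shows "rayleigh_class (bessel_fps \<nu> 0)"
proof -
  define S where "S = neg_logderiv (bessel_fps \<nu> 0)"
  \<comment> \<open>\<open>A\<close> is the constant coefficient of \<open>S\<close>.
    \<open>q\<close> is chosen so that \<open>A * q * (k + \<nu> + 1) \<le> k * A\<^sup>2\<close>
    for every \<open>k \<ge> 1\<close>, which is what the induction step requires.\<close>
  define A where "A = 1 / (4 * (\<nu> + 1))"
  define q where "q = A / (\<nu> + 2)"
  have pos: "A > 0" "q > 0" using assms by (auto simp: A_def q_def)
  have "Gamma (\<nu> + 1) > 0" using assms by (intro Gamma_real_pos) auto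
  hence B0: "fps_nth (bessel_fps \<nu> 0) 0 \<noteq> 0" by (simp add: bessel_fps_def)
  note ric = neg_logderiv_bessel_fps_0_riccati[OF assms, folded S_def]
  have rec0: "of_real (\<nu> + 1) * fps_nth S 0 = 1 / 4"
    using arg_cong[OF ric, of "\<lambda>F. fps_nth F 0"] by (simp add: field_simps)
  have rec: "of_real (real (Suc k) + \<nu> + 1) * fps_nth S (Suc k)
               = (\<Sum>i=0..k. fps_nth S i * fps_nth S (k - i))" for k
  proof -
    have "4 * ((of_nat k + 1) * fps_nth S (Suc k)) + (4 * of_real \<nu> + 4) * fps_nth S (Suc k)
            = 4 * fps_nth (S * S) k"
      using arg_cong[OF ric, of "\<lambda>F. fps_nth F (Suc k)"]
      by (simp add: mult.assoc numeral_fps_const add_ac)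
    hence "4 * (of_real (real (Suc k) + \<nu> + 1) * fps_nth S (Suc k)) = 4 * fps_nth (S * S) k"
      by (simp add: algebra_simps)
    thus ?thesis by (simp add: fps_mult_nth)
  qed
  have S: "fps_nth S k \<in> \<real> \<and> A * q ^ k \<le> Re (fps_nth S k)" for k
  proof (induction k rule: less_induct)
    case (less k)
    show ?case
    proof (cases k)
      case 0
      have "of_real (\<nu> + 1) \<noteq> (0 :: complex)"
        using assms by (simp only: of_real_eq_0_iff)
      hence "fps_nth S 0 = 1 / 4 / of_real (\<nu> + 1)"
        using rec0 by (simp only: eq_divide_eq mult.commute) simp
      hence "fps_nth S 0 = of_real A" by (simp add: A_def)
      thus ?thesis by (simp add: 0)
    next
      case (Suc j)
      define s where "s i = Re (fps_nth S i)" for i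
      have s: "fps_nth S i = of_real (s i)" "A * q ^ i \<le> s i" if "i < k" for i
        using less that by (auto simp: s_def)
      define T where "T = (\<Sum>i=0..j. s i * s (j - i))"
      have p: "real k + \<nu> + 1 > 0" using assms by linarith
      have "of_real (real k + \<nu> + 1) * fps_nth S k = of_real T"
        unfolding Suc rec T_def of_real_sum by (intro sum.cong refl) (auto simp: s Suc)
      hence Sk: "fps_nth S k = of_real (T / (real k + \<nu> + 1))"
        using p by (simp add: field_simps del: of_real_add)
      \<comment> \<open>The convolution has \<open>j + 1 = k\<close> terms, each at least
        \<open>A\<^sup>2 * q ^ j\<close> by the induction hypothesis.\<close>
      have "(\<Sum>i=0..j. A * q ^ i * (A * q ^ (j - i))) \<le> T"
        unfolding T_def using pos s Suc
        by (intro sum_mono mult_mono) (auto intro: order_trans[OF _ s(2)])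
      also have "(\<Sum>i=0..j. A * q ^ i * (A * q ^ (j - i))) = (\<Sum>i=0..j. A\<^sup>2 * q ^ j)"
        by (intro sum.cong refl) (auto simp: power2_eq_square power_add[symmetric] mult_ac simp flip: mult.assoc)
      also have "\<dots> = real k * A\<^sup>2 * q ^ j" by (simp add: Suc)
      finally have T: "real k * A\<^sup>2 * q ^ j \<le> T" .
      have "A * q * (real k + \<nu> + 1) \<le> real k * A\<^sup>2"
      proof -
        \<comment> \<open>The right side exceeds the left by \<open>(\<nu> + 1) * j\<close>, since
          \<open>k = j + 1\<close>.\<close>
        have "real k + \<nu> + 1 \<le> real k * (\<nu> + 2)"
          using assms Suc mult_nonneg_nonneg[of "\<nu> + 1" "real j"] by (simp add: algebra_simps)
        hence "A\<^sup>2 / (\<nu> + 2) * (real k + \<nu> + 1) \<le> A\<^sup>2 / (\<nu> + 2) * (real k * (\<nu> + 2))"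
          using assms by (intro mult_left_mono) auto
        also have "\<dots> = real k * A\<^sup>2" using assms by simp
        finally show ?thesis by (simp add: q_def power2_eq_square)
      qed
      hence "A * q * (real k + \<nu> + 1) * q ^ j \<le> real k * A\<^sup>2 * q ^ j"
        using pos by (intro mult_right_mono) auto
      with T have "A * q ^ k * (real k + \<nu> + 1) \<le> T" by (simp add: Suc mult_ac)
      thus ?thesis using p by (simp add: Sk field_simps)
    qed
  qed
  have "nonneg_fps S"
    unfolding nonneg_fps_def complex_nonneg_Reals_iff
  proof
    fix k
    have "0 \<le> A * q ^ k" using pos by simp
    thus "0 \<le> Re (fps_nth S k) \<and> Im (fps_nth S k) = 0"
      using S[of k] by (auto simp: complex_is_Real_iff)
  qed
  thus ?thesis
    unfolding rayleigh_class_def S_def[symmetric] using S pos B0 bessel_fps_conv_radius[OF assms]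
    by blast
qed

lemma bessel_fps_Suc_eq_bessel_op: "bessel_fps \<nu> (Suc n) = bessel_op (\<nu> - real n) (bessel_fps \<nu> n)"
  by (simp add: bessel_fps_Suc bessel_op_def)

lemma rayleigh_class_bessel_fps:
  assumes "\<nu> > -1" "\<nu> > real n - 1"
  shows "rayleigh_class (bessel_fps \<nu> n)"
  using assms(2)
proof (induction n)
  case 0
  show ?case using assms(1) by (rule rayleigh_class_bessel_fps_0)
next
  case (Suc n)
  thus ?case unfolding bessel_fps_Suc_eq_bessel_op
    by (intro rayleigh_class_bessel_op) auto
qed

subsection \<open>The first zero\<close>

lemma nonneg_fps_eval_sums:
  assumes "nonneg_fps K" "0 \<le> r" "ereal r < fps_conv_radius K"
  shows "(\<lambda>k. Re (fps_nth K k) * r ^ k) sums Re (eval_fps K (of_real r))"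
proof -
  have "(\<lambda>k. fps_nth K k * of_real r ^ k) sums eval_fps K (of_real r)"
    using assms by (intro sums_eval_fps) auto
  from sums_Re[OF this] show ?thesis
    by (simp flip: of_real_power)
qed

lemma nonneg_fps_Re_nth: "nonneg_fps K \<Longrightarrow> 0 \<le> Re (fps_nth K k)"
  by (simp add: nonneg_fps_def complex_nonneg_Reals_iff)

lemma nonneg_fps_norm_nth: "nonneg_fps K \<Longrightarrow> norm (fps_nth K k) = Re (fps_nth K k)"
  by (simp add: nonneg_fps_def nonneg_Reals_cmod_eq_Re)

lemma nonneg_fps_eval_real:
  assumes "nonneg_fps K" "0 \<le> r" "ereal r < fps_conv_radius K"
  shows "eval_fps K (of_real r) = of_real (Re (eval_fps K (of_real r)))"
proof -
  have "(\<lambda>k. of_real (Re (fps_nth K k) * r ^ k)) sums (of_real (Re (eval_fps K (of_real r))) :: complex)"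
    using nonneg_fps_eval_sums[OF assms] by (simp only: sums_of_real_iff)
  moreover have "of_real (Re (fps_nth K k)) = fps_nth K k" for k
  proof -
    have "fps_nth K k \<in> \<real>" using assms(1) by (auto simp: nonneg_fps_def)
    thus ?thesis by (rule of_real_Re)
  qed
  ultimately have "(\<lambda>k. fps_nth K k * of_real r ^ k) sums of_real (Re (eval_fps K (of_real r)))"
    by (simp only: of_real_mult of_real_power)
  moreover have "(\<lambda>k. fps_nth K k * of_real r ^ k) sums eval_fps K (of_real r)"
    using assms by (intro sums_eval_fps) auto
  ultimately show ?thesis using sums_unique2 by blast
qed

text \<open>This is the triangle inequality, with each coefficient equal to its own norm. It makes
  the positive real point extremal on every circle.\<close>

lemma nonneg_fps_norm_eval_le:
  assumes "nonneg_fps K" "ereal (norm w) < fps_conv_radius K"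
  shows "norm (eval_fps K w) \<le> Re (eval_fps K (of_real (norm w)))"
proof -
  note s = nonneg_fps_eval_sums[OF assms(1) norm_ge_zero assms(2)]
  have "norm (fps_nth K k * w ^ k) = Re (fps_nth K k) * norm w ^ k" for k
    using assms(1) by (simp add: norm_mult norm_power nonneg_fps_norm_nth)
  with s have n: "(\<lambda>k. norm (fps_nth K k * w ^ k)) sums Re (eval_fps K (of_real (norm w)))"
    by (simp only:)
  show ?thesis
    using summable_norm[OF sums_summable[OF n]] unfolding sums_unique[OF n] eval_fps_def[of K w] .
qed

lemma nonneg_fps_eval_mono:
  assumes "nonneg_fps K" "0 \<le> r" "r \<le> s" "ereal s < fps_conv_radius K"
  shows "Re (eval_fps K (of_real r)) \<le> Re (eval_fps K (of_real s))"
proof (rule sums_le)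
  have "ereal r < fps_conv_radius K"
    using assms(3,4) by (meson ereal_less_eq(3) le_less_trans)
  thus "(\<lambda>k. Re (fps_nth K k) * r ^ k) sums Re (eval_fps K (of_real r))"
    by (intro nonneg_fps_eval_sums assms)
  show "(\<lambda>k. Re (fps_nth K k) * s ^ k) sums Re (eval_fps K (of_real s))"
    using assms by (intro nonneg_fps_eval_sums) auto
  show "Re (fps_nth K k) * r ^ k \<le> Re (fps_nth K k) * s ^ k" for k
    using assms by (intro mult_left_mono power_mono nonneg_fps_Re_nth)
qed

lemma nonneg_fps_eval_ge:
  assumes "nonneg_fps K" "0 \<le> r" "ereal r < fps_conv_radius K"
  shows "Re (fps_nth K 0) \<le> Re (eval_fps K (of_real r))"
  using nonneg_fps_eval_mono[of K 0 r] assms by (simp add: eval_fps_at_0)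

section \<open>Primitives and the exponential representation of \<open>P\<close>\<close>

lemma fps_conv_radius_integral0:
  fixes F :: "complex fps"
  shows "fps_conv_radius F \<le> fps_conv_radius (fps_integral0 F)"
proof -
  have "fps_conv_radius F \<le> fps_conv_radius (fps_shift 1 (fps_integral0 F))"
    unfolding fps_conv_radius_def
  proof (rule conv_radius_geI_ex')
    fix r :: real assume r: "0 < r" "ereal r < conv_radius (fps_nth F)"
    have "summable (\<lambda>n. norm (fps_nth F n * of_real r ^ n))"
      using r by (intro abs_summable_in_conv_radius) auto
    thus "summable (\<lambda>n. fps_nth (fps_shift 1 (fps_integral0 F)) n * of_real r ^ n)"
    proof (rule summable_comparison_test'[of _ 0])
      fix n
      have "norm (inverse (of_nat (Suc n)) * fps_nth F n) \<le> 1 * norm (fps_nth F n)"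
        unfolding norm_mult norm_inverse norm_of_nat
        by (intro mult_right_mono) (auto simp: divide_simps)
      thus "norm (fps_nth (fps_shift 1 (fps_integral0 F)) n * of_real r ^ n) \<le> norm (fps_nth F n * of_real r ^ n)"
        unfolding norm_mult[of _ "of_real r ^ n"] by (intro mult_right_mono) auto
    qed
  qed
  thus ?thesis by simp
qed

lemma eval_fps_integral0_deriv:
  fixes F :: "complex fps"
  assumes "ereal (norm w) < fps_conv_radius F"
  shows "(eval_fps (fps_integral0 F) has_field_derivative eval_fps F w) (at w)"
  using has_field_derivative_eval_fps[of w "fps_integral0 F" UNIV] assms
    fps_conv_radius_integral0[of F] by (simp add: fps_deriv_fps_integral)

context
  fixes P S L :: "complex fps"
  assumes P: "fps_conv_radius P = \<infinity>" "fps_nth P 0 \<noteq> 0"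
  defines "S \<equiv> neg_logderiv P"
  defines "L \<equiv> fps_integral0 S"
begin

lemma eval_neg_logderiv_mult:
  assumes w: "ereal (norm w) < fps_conv_radius S"
  shows "eval_fps S w * eval_fps P w = - eval_fps (fps_deriv P) w"
proof -
  have "fps_conv_radius (fps_deriv P) = \<infinity>"
    using fps_conv_radius_deriv[of P] P by simp
  thus ?thesis
    using neg_logderiv_mult_self[OF P(2)] eval_fps_mult[of w S P] w P
    by (simp add: S_def eval_fps_minus)
qed

text \<open>\<open>P * exp L\<close> has derivative \<open>(P' + S * P) * exp L = 0\<close> on the
  disc of convergence of \<open>S\<close>, possibly the whole plane, and \<open>L\<close> vanishes
  at 0. In particular no zero of \<open>P\<close> lies in that disc.\<close>

lemma eval_eq_exp_integral:
  assumes w: "ereal (norm w) < fps_conv_radius S"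
  shows "eval_fps P w = fps_nth P 0 * exp (- eval_fps L w)"
proof -
  define R where "R = fps_conv_radius S"
  have "\<exists>c. \<forall>z\<in>eball 0 R. eval_fps P z * exp (eval_fps L z) = c"
  proof (rule has_field_derivative_zero_constant)
    show "convex (eball 0 R :: complex set)"
      by (cases R) auto
    fix z :: complex assume z: "z \<in> eball 0 R"
    hence z': "ereal (norm z) < fps_conv_radius S" by (simp add: R_def)
    have "((\<lambda>z. eval_fps P z * exp (eval_fps L z)) has_field_derivative
       (eval_fps (fps_deriv P) z * exp (eval_fps L z) + exp (eval_fps L z) * eval_fps S z * eval_fps P z)) (at z)"
      unfolding L_def using P z'
      by (intro DERIV_mult DERIV_fun_exp has_field_derivative_eval_fps eval_fps_integral0_deriv) auto
    hence "((\<lambda>z. eval_fps P z * exp (eval_fps L z)) has_field_derivative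
       (eval_fps (fps_deriv P) z * exp (eval_fps L z) + exp (eval_fps L z) * eval_fps S z * eval_fps P z)) (at z within eball 0 R)"
      by (rule has_field_derivative_at_within)
    also have "eval_fps (fps_deriv P) z * exp (eval_fps L z) + exp (eval_fps L z) * eval_fps S z * eval_fps P z = 0"
      using eval_neg_logderiv_mult[OF z'] by (simp add: mult.assoc)
    finally show "((\<lambda>z. eval_fps P z * exp (eval_fps L z)) has_field_derivative 0) (at z within eball 0 R)" .
  qed
  then obtain c where c: "\<And>z. z \<in> eball 0 R \<Longrightarrow> eval_fps P z * exp (eval_fps L z) = c" by blast
  have "0 \<le> ereal (norm w)" by simp
  also have "\<dots> < R" using w by (simp add: R_def)
  finally have "(0::complex) \<in> eball 0 R" by (simp add: zero_ereal_def)
  from c[OF this] c[of w] w have "eval_fps P w * exp (eval_fps L w) = fps_nth P 0"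
    by (simp add: eval_fps_at_0 L_def R_def)
  thus ?thesis by (simp add: exp_minus field_simps)
qed

lemma eval_nonzero:
  assumes w: "ereal (norm w) < fps_conv_radius S"
  shows "eval_fps P w \<noteq> 0"
  using eval_eq_exp_integral[OF w] P by simp

lemma eval_neg_logderiv:
  assumes w: "ereal (norm w) < fps_conv_radius S"
  shows "eval_fps S w = - eval_fps (fps_deriv P) w / eval_fps P w"
  using eval_neg_logderiv_mult[OF w] eval_nonzero[OF w] by (simp add: field_simps)

end

text \<open>Pringsheim's theorem for the logarithmic derivative: since the coefficients of its
  primitive are nonnegative, |P| is minimal on each circle at the positive real point.\<close>

lemma rayleigh_class_radius:
  assumes "rayleigh_class P"
  obtains R where "fps_conv_radius (neg_logderiv P) = ereal R" "0 < R" "eval_fps P (of_real R) = 0"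
proof -
  define S where "S = neg_logderiv P"
  define L where "L = fps_integral0 S"
  from assms obtain A q where A: "A > 0" "q > 0" "\<And>k. A * q ^ k \<le> Re (fps_nth S k)"
    and P: "fps_conv_radius P = \<infinity>" "fps_nth P 0 \<noteq> 0" and S: "nonneg_fps S"
    unfolding rayleigh_class_def S_def by blast
  \<comment> \<open>At the point \<open>1 / q\<close> the terms of the series stay above
    \<open>A\<close>, so the series cannot converge there.\<close>
  have fin: "fps_conv_radius S \<le> ereal (1 / q)"
  proof (rule ccontr)
    assume "\<not> ?thesis"
    hence "summable (\<lambda>k. Re (fps_nth S k) * (1 / q) ^ k)"
      using A nonneg_fps_eval_sums[OF S, of "1 / q"] by (simp add: sums_iff)
    hence "(\<lambda>k. Re (fps_nth S k) * (1 / q) ^ k) \<longlonglongrightarrow> 0"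
      by (rule summable_LIMSEQ_zero)
    moreover have "A \<le> Re (fps_nth S k) * (1 / q) ^ k" for k
      using A by (simp add: field_simps)
    ultimately have "A \<le> 0" by (intro LIMSEQ_le_const) auto
    with A show False by simp
  qed
  have "fps_conv_radius S \<ge> 0" by (simp add: fps_conv_radius_def conv_radius_nonneg)
  with fin obtain R where R: "fps_conv_radius S = ereal R" "0 \<le> R"
    by (cases "fps_conv_radius S") auto
  have cont: "continuous_on UNIV (eval_fps P)"
    using continuous_on_eval_fps[of P] P by simp
  \<comment> \<open>If \<open>P\<close> had no zero on the closed disc, compactness would keep its
    zeros at a distance \<open>d > 0\<close> from it. Then \<open>1 / P\<close>, and with it
    \<open>S\<close>, would converge up to \<open>R + d\<close>.\<close>
  have "\<exists>w\<in>cball 0 R. eval_fps P w = 0"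
  proof (rule ccontr)
    assume *: "\<not> ?thesis"
    define Z where "Z = {w. eval_fps P w = 0}"
    have "closed Z" unfolding Z_def
      by (intro closed_Collect_eq cont continuous_on_const)
    moreover have "compact (cball (0 :: complex) R)" by simp
    moreover have "cball 0 R \<inter> Z = {}" using * by (auto simp: Z_def)
    ultimately have "\<exists>d>0. \<forall>x\<in>cball 0 R. \<forall>y\<in>Z. d \<le> dist x y"
      by (intro separate_compact_closed)
    then obtain d where d: "d > 0" "\<And>x y. x \<in> cball 0 R \<Longrightarrow> y \<in> Z \<Longrightarrow> d \<le> dist x y"
      by blast
    have nz: "eval_fps P z \<noteq> 0" if "z \<in> eball 0 (ereal (R + d))" for z
    proof
      assume "eval_fps P z = 0"
      hence z: "z \<in> Z" by (simp add: Z_def)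
      show False
      proof (cases "norm z \<le> R")
        case True
        thus False using d(2)[of z z] d(1) z by simp
      next
        case False
        \<comment> \<open>\<open>x\<close> is the radial projection of \<open>z\<close> onto the
          circle of radius \<open>R\<close>, at distance \<open>norm z - R < d\<close> from
          \<open>z\<close>.\<close>
        define x where "x = of_real (R / norm z) * z"
        have n: "norm z > 0" using False R by linarith
        have "norm x = R" using n R unfolding x_def norm_mult norm_of_real by simp
        have "z - x = of_real (1 - R / norm z) * z" by (simp add: x_def algebra_simps)
        hence "dist x z = \<bar>1 - R / norm z\<bar> * norm z"
          by (simp only: dist_norm norm_minus_commute[of x] norm_mult norm_of_real)
        also have "\<dots> = \<bar>norm z - R\<bar>" using n by (simp add: abs_if field_simps)
        finally have "dist x z < d" using that False by simp
        with d(2)[of x z] z \<open>norm x = R\<close> show False by simp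
      qed
    qed
    have "fps_conv_radius (inverse P) \<ge> min (ereal (R + d)) (fps_conv_radius P)"
      using d R by (intro fps_conv_radius_inverse nz) (auto)
    hence "fps_conv_radius (inverse P) \<ge> ereal (R + d)" using P by simp
    moreover have "fps_conv_radius (- fps_deriv P) = \<infinity>"
      using fps_conv_radius_deriv[of P] P by simp
    ultimately have "fps_conv_radius S \<ge> ereal (R + d)"
      unfolding S_def neg_logderiv_def by (intro fps_conv_radius_mult_ge) auto
    thus False using R d by simp
  qed
  then obtain w0 where w0: "norm w0 \<le> R" "eval_fps P w0 = 0" by auto
  have nw0: "norm w0 = R"
  proof (rule ccontr)
    assume "norm w0 \<noteq> R"
    hence "ereal (norm w0) < fps_conv_radius (neg_logderiv P)" using w0 R by (simp add: S_def)
    from eval_nonzero[OF P this] w0 show False by simp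
  qed
  \<comment> \<open>Positivity of the radius is obtained only here: the zero \<open>w0\<close> has
    norm \<open>R\<close> and is not the origin.\<close>
  have "w0 \<noteq> 0" using w0 P by (auto simp: eval_fps_at_0)
  hence R0: "R > 0" using nw0 by auto
  have L: "nonneg_fps L"
    unfolding nonneg_fps_def
  proof
    fix k show "fps_nth L k \<in> \<real>\<^sub>\<ge>\<^sub>0"
      using S unfolding nonneg_fps_def L_def
      by (cases k) (auto intro!: nonneg_Reals_mult_I nonneg_Reals_inverse_I simp del: of_nat_Suc)
  qed
  have RL: "ereal R \<le> fps_conv_radius L"
    using fps_conv_radius_integral0[of S] R by (simp add: L_def)
  \<comment> \<open>Inside the disc \<open>norm (P w)\<close> is
    \<open>norm (P 0) * exp (- Re (L w))\<close>, and \<open>Re (L w)\<close> is at most the value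
    of \<open>L\<close> at \<open>norm w\<close>. The comparison is made at radius
    \<open>t * R\<close> because the representation is available only strictly inside.\<close>
  have le: "norm (eval_fps P (of_real (t * R))) \<le> norm (eval_fps P (of_real t * w0))" if t: "0 < t" "t < 1" for t
  proof -
    define w where "w = of_real t * w0"
    have nw: "norm w = t * R" using t nw0 by (simp add: w_def norm_mult)
    have lt: "t * R < R" using t R0 by simp
    have lt': "ereal (t * R) < fps_conv_radius (neg_logderiv P)" using lt R by (simp add: S_def)
    have ltL: "ereal (t * R) < fps_conv_radius L"
      using lt RL by (meson ereal_less(2) less_ereal.simps(1) less_le_trans)
    have "Re (eval_fps L w) \<le> Re (eval_fps L (of_real (t * R)))"
      using complex_Re_le_cmod[of "eval_fps L w"] nonneg_fps_norm_eval_le[OF L, of w] ltL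
      unfolding nw by simp
    moreover have "norm (complex_of_real (t * R)) = t * R" using t R0 by (simp del: of_real_mult)
    ultimately show ?thesis
      using eval_eq_exp_integral[OF P, of w] eval_eq_exp_integral[OF P, of "of_real (t * R)"] nw lt' P
      by (simp add: norm_mult w_def[symmetric] L_def S_def del: of_real_mult)
  qed
  \<comment> \<open>Letting \<open>t\<close> tend to 1 from below moves the comparison to the
    boundary circle, where the right side becomes \<open>norm (P w0) = 0\<close>.\<close>
  have lim: "((\<lambda>t. norm (eval_fps P (of_real t * c))) \<longlongrightarrow> norm (eval_fps P c)) (at_left 1)" for c
  proof -
    have "continuous_on UNIV (\<lambda>t::real. norm (eval_fps P (of_real t * c)))"
      using P by (intro continuous_intros) auto
    hence "((\<lambda>t::real. norm (eval_fps P (of_real t * c))) \<longlongrightarrow> norm (eval_fps P (of_real 1 * c))) (at 1)"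
      unfolding continuous_on_eq_continuous_at[OF open_UNIV] isCont_def by blast
    thus ?thesis by (simp add: filterlim_at_split)
  qed
  have "eventually (\<lambda>t::real. t \<in> {0<..<1}) (at_left 1)"
    by (rule eventually_at_left_real) simp
  hence "eventually (\<lambda>t. norm (eval_fps P (of_real t * of_real R)) \<le> norm (eval_fps P (of_real t * w0))) (at_left 1)"
    by eventually_elim (use le in auto)
  from tendsto_le[OF _ lim lim this] have "eval_fps P (of_real R) = 0" using w0 by simp
  with R R0 show ?thesis by (intro that[of R]) (simp_all add: S_def)
qed

text \<open>A bound \<open>S \<le> M\<close> on the interval would give
  \<open>L r \<le> M * r\<close> by integration, hence
  \<open>norm (P r) * exp (M * r) \<ge> norm (P 0) > 0\<close>. In the limit at \<open>R\<close>
  this contradicts the zero of \<open>P\<close>.\<close>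

lemma neg_logderiv_unbounded:
  assumes P: "rayleigh_class P" and R: "fps_conv_radius (neg_logderiv P) = ereal R"
    and R0: "0 < R" and zero: "eval_fps P (of_real R) = 0"
  shows "\<exists>r. 0 < r \<and> r < R \<and> M < Re (eval_fps (neg_logderiv P) (of_real r))"
proof (rule ccontr)
  define S where "S = neg_logderiv P"
  define L where "L = fps_integral0 S"
  assume "\<not> ?thesis"
  hence M: "Re (eval_fps S (of_real r)) \<le> M" if "0 < r" "r < R" for r
    using that unfolding S_def by (meson not_less)
  from P have P: "fps_conv_radius P = \<infinity>" "fps_nth P 0 \<noteq> 0" and S: "nonneg_fps S"
    unfolding rayleigh_class_def S_def by auto
  have RS: "fps_conv_radius S = ereal R" using R by (simp add: S_def)
  define f where "f r = norm (eval_fps P (of_real r)) * exp (M * r)" for r :: real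
  have f: "norm (fps_nth P 0) \<le> f r" if r: "0 < r" "r < R" for r
  proof -
    have d: "((\<lambda>x. M * x - Re (eval_fps L (of_real x))) has_real_derivative (M - Re (eval_fps S (of_real x)))) (at x)" 
      if "0 \<le> x" "x \<le> r" for x
    proof -
      have "(eval_fps L has_field_derivative eval_fps S (of_real x)) (at (of_real x))"
        unfolding L_def using RS that r by (intro eval_fps_integral0_deriv) auto
      hence "((\<lambda>x. eval_fps L (of_real x)) has_vector_derivative eval_fps S (of_real x)) (at x)"
        by (auto dest!: has_vector_derivative_real_field)
      hence "((\<lambda>x. Re (eval_fps L (of_real x))) has_real_derivative Re (eval_fps S (of_real x))) (at x)"
        unfolding has_vector_derivative_complex_iff by blast
      thus ?thesis
        by (intro DERIV_diff) (auto intro!: derivative_eq_intros)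
    qed
    have "M * 0 - Re (eval_fps L (of_real 0)) \<le> M * r - Re (eval_fps L (of_real r))"
    proof (rule DERIV_nonneg_imp_nondecreasing[where f = "\<lambda>x. M * x - Re (eval_fps L (of_real x))"])
      show "0 \<le> r" using r by simp
      fix x assume x: "0 \<le> x" "x \<le> r"
      \<comment> \<open>Passing to \<open>r\<close> by monotonicity covers \<open>x = 0\<close> as
        well, since the assumed bound speaks only of positive arguments.\<close>
      have "Re (eval_fps S (of_real x)) \<le> Re (eval_fps S (of_real r))"
        using x r by (intro nonneg_fps_eval_mono S) (auto simp: RS)
      also have "\<dots> \<le> M" using r by (intro M)
      finally show "\<exists>y. ((\<lambda>x. M * x - Re (eval_fps L (of_real x))) has_real_derivative y) (at x) \<and> 0 \<le> y"
        using d[OF x] by (intro exI conjI) auto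
    qed
    hence "Re (eval_fps L (of_real r)) \<le> M * r" by (simp add: eval_fps_at_0 L_def)
    moreover have "eval_fps P (of_real r) = fps_nth P 0 * exp (- eval_fps L (of_real r))"
      unfolding L_def S_def using R r by (intro eval_eq_exp_integral[OF P]) auto
    ultimately show ?thesis
      using P by (simp add: f_def norm_mult mult.assoc flip: exp_add)
  qed
  have "continuous_on UNIV f" unfolding f_def
    using P by (intro continuous_intros) auto
  hence "isCont f R" by (simp add: continuous_on_eq_continuous_at)
  hence "(f \<longlongrightarrow> f R) (at_left R)" by (simp add: isCont_def filterlim_at_split)
  moreover have "eventually (\<lambda>r. r \<in> {0<..<R}) (at_left R)"
    using R0 by (intro eventually_at_left_real)
  hence "eventually (\<lambda>r. norm (fps_nth P 0) \<le> f r) (at_left R)"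
    by eventually_elim (use f in auto)
  ultimately have "norm (fps_nth P 0) \<le> f R"
    by (intro tendsto_lowerbound[of f _ "at_left R"]) auto
  thus False using zero P by (simp add: f_def)
qed

subsection \<open>Convexity radius and level points\<close>

text \<open>On the positive axis \<open>r * K r\<close> is continuous, starts at 0 and is unbounded,
  so it takes the value \<open>b\<close>. For \<open>norm w < x\<close> the real part of
  \<open>w * K w\<close> is at most \<open>norm w * K (norm w)\<close>, and positivity of
  \<open>K x\<close> makes the final comparison strict.\<close>

lemma nonneg_fps_level_point:
  assumes K: "nonneg_fps K" "0 < Re (fps_nth K 0)" and R: "0 < R" "ereal R \<le> fps_conv_radius K"
    and unbounded: "\<And>M. \<exists>r. 0 < r \<and> r < R \<and> M < Re (eval_fps K (of_real r))" and b: "0 < b"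
  obtains x where "0 < x" "x < R" "x * Re (eval_fps K (of_real x)) = b"
    "\<And>w. norm w < x \<Longrightarrow> Re (w * eval_fps K w) < b"
proof -
  define k where "k r = Re (eval_fps K (of_real r))" for r
  have RK: "ereal r < fps_conv_radius K" if "r < R" for r
    using R(2) that by (meson ereal_less(2) less_ereal.simps(1) less_le_trans)
  have mono: "k r \<le> k s" if "0 \<le> r" "r \<le> s" "s < R" for r s
    unfolding k_def using that by (intro nonneg_fps_eval_mono K RK)
  have pos: "0 < k r" if "0 \<le> r" "r < R" for r
    using nonneg_fps_eval_ge[OF K(1) that(1) RK[OF that(2)]] K(2) by (simp add: k_def)
  \<comment> \<open>Exceeding \<open>k (R / 2)\<close> forces \<open>r1 \<ge> R / 2\<close> by
    monotonicity, and exceeding \<open>2 * b / R\<close> then gives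
    \<open>r1 * k r1 \<ge> b\<close>.\<close>
  obtain r1 where r1: "0 < r1" "r1 < R" "max (2 * b / R) (k (R / 2)) < k r1"
    using unbounded unfolding k_def by blast
  have "R / 2 \<le> r1"
  proof (rule ccontr)
    assume "\<not> ?thesis"
    hence "k r1 \<le> k (R / 2)" using r1 R by (intro mono) auto
    thus False using r1 by simp
  qed
  hence "R / 2 * (2 * b / R) \<le> r1 * k r1"
    using r1 R b by (intro mult_mono) auto
  hence b_le: "b \<le> r1 * k r1" using R by simp
  have "continuous_on {0..r1} (\<lambda>r. r * k r)"
    unfolding k_def using RK r1 by (intro continuous_intros) auto
  hence "\<exists>x\<ge>0. x \<le> r1 \<and> x * k x = b"
    using b r1 b_le by (intro IVT') auto
  then obtain x where x: "0 \<le> x" "x \<le> r1" "x * k x = b" by blast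
  have x0: "0 < x" using x b by (cases "x = 0") auto
  have xR: "x < R" using x r1 by simp
  have "Re (w * eval_fps K w) < b" if w: "norm w < x" for w
  proof -
    have "Re (w * eval_fps K w) \<le> norm w * norm (eval_fps K w)"
      by (metis complex_Re_le_cmod norm_mult)
    also have "\<dots> \<le> norm w * k (norm w)"
      unfolding k_def using w xR by (intro mult_left_mono nonneg_fps_norm_eval_le K RK) auto
    also have "\<dots> \<le> norm w * k x"
      using w xR by (intro mult_left_mono mono) auto
    also have "\<dots> < x * k x"
      using w pos[of x] xR x0 by (intro mult_strict_right_mono) auto
    finally show ?thesis using x by simp
  qed
  with x0 xR x show ?thesis by (intro that[of x]) (auto simp: k_def)
qed

text \<open>The case \<open>K = neg_logderiv P\<close>, used for \<open>g\<close> and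
  \<open>h\<close>. The level is attained as an equality of complex numbers, the form in which it
  enters the root equations.\<close>

lemma rayleigh_class_level_point:
  assumes P: "rayleigh_class P" and b: "0 < b"
  obtains x R where "fps_conv_radius (neg_logderiv P) = ereal R" "0 < x" "x < R"
    "of_real x * eval_fps (neg_logderiv P) (of_real x) = of_real b"
    "\<And>w. norm w < x \<Longrightarrow> Re (w * eval_fps (neg_logderiv P) w) < b"
proof -
  define S where "S = neg_logderiv P"
  obtain R where R: "fps_conv_radius (neg_logderiv P) = ereal R" "0 < R" "eval_fps P (of_real R) = 0"
    using rayleigh_class_radius[OF P] .
  from P obtain A q where A: "A > 0" "\<And>k. A * q ^ k \<le> Re (fps_nth S k)" and S: "nonneg_fps S"
    unfolding rayleigh_class_def S_def by blast
  have "0 < Re (fps_nth S 0)" using A(1) A(2)[of 0] by simp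
  then obtain x where x: "0 < x" "x < R" "x * Re (eval_fps S (of_real x)) = b"
    "\<And>w. norm w < x \<Longrightarrow> Re (w * eval_fps S w) < b"
    using nonneg_fps_level_point[OF S _ R(2) _ _ b] R neg_logderiv_unbounded[OF P R]
    by (metis S_def order_refl)
  have "eval_fps S (of_real x) = of_real (Re (eval_fps S (of_real x)))"
    using S x R by (intro nonneg_fps_eval_real) (auto simp: S_def)
  hence "of_real x * eval_fps S (of_real x) = of_real b"
    using x(3) by (metis of_real_mult)
  with x R(1) show ?thesis by (intro that) (auto simp: S_def)
qed

text \<open>With \<open>Q = bessel_op c P = P * (c - 2 * w * S)\<close>, the point
  \<open>x < R\<close> at level \<open>c / 2\<close> is a zero of \<open>Q\<close>. No zero of
  \<open>Q\<close> lies inside the disc of its own logarithmic derivative, whence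
  \<open>R' \<le> x\<close>. This is the source of the strict inequality between the first zeros of
  consecutive derivatives.\<close>

lemma rayleigh_class_bessel_op_radius_less:
  assumes P: "rayleigh_class P" and c: "0 < c"
    and R: "fps_conv_radius (neg_logderiv P) = ereal R"
    and R': "fps_conv_radius (neg_logderiv (bessel_op c P)) = ereal R'"
  shows "R' < R"
proof -
  have Pc: "fps_conv_radius P = \<infinity>" "fps_nth P 0 \<noteq> 0"
    using P by (auto simp: rayleigh_class_def)
  have Qc: "fps_conv_radius (bessel_op c P) = \<infinity>" "fps_nth (bessel_op c P) 0 \<noteq> 0"
    using rayleigh_class_bessel_op[OF P c] by (auto simp: rayleigh_class_def)
  obtain x where x: "0 < x" "x < R" "of_real x * eval_fps (neg_logderiv P) (of_real x) = of_real (c / 2)"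
    using rayleigh_class_level_point[OF P, of "c / 2"] R c
    by (metis ereal.inject half_gt_zero)
  have xn: "ereal (norm (of_real x :: complex)) < fps_conv_radius (neg_logderiv P)"
    using x R by simp
  have "eval_fps (bessel_op c P) (of_real x)
          = of_real c * eval_fps P (of_real x) - 2 * of_real x * (eval_fps (neg_logderiv P) (of_real x) * eval_fps P (of_real x))"
    unfolding eval_bessel_op[OF Pc(1)] eval_neg_logderiv_mult[OF Pc xn] by simp
  also have "\<dots> = of_real c * eval_fps P (of_real x)
      - 2 * (of_real x * eval_fps (neg_logderiv P) (of_real x)) * eval_fps P (of_real x)"
    by (simp only: mult.assoc)
  also have "\<dots> = 0" unfolding x(3) by simp
  finally have "\<not> ereal (norm (of_real x :: complex)) < fps_conv_radius (neg_logderiv (bessel_op c P))"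
    using eval_nonzero[OF Qc] by blast
  hence "R' \<le> x" using R' x by simp
  with x show ?thesis by simp
qed

text \<open>\<open>f\<close> matters only through its germ at 0, so it may be replaced by
  \<open>\<phi>\<close>, whose Taylor series converges on the disc of radius \<open>C\<close>. Every
  disc of radius larger than \<open>\<rho>\<close> contains the point \<open>\<rho>\<close>, where
  the inequality fails; hence nothing has to be known beyond \<open>C\<close>.\<close>

lemma convexity_radius_eqI:
  assumes \<rho>: "0 < \<rho>" "\<rho> < C"
    and f: "eventually (\<lambda>z. f z = \<phi> z) (nhds 0)"
    and d1: "\<And>z. norm z < C \<Longrightarrow> (\<phi> has_field_derivative \<phi>' z) (at z)"
    and d2: "\<And>z. norm z < C \<Longrightarrow> (\<phi>' has_field_derivative \<phi>'' z) (at z)"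
    and nz: "\<And>z. norm z < \<rho> \<Longrightarrow> \<phi>' z \<noteq> 0"
    and inside: "\<And>z. norm z < \<rho> \<Longrightarrow> \<beta> < Re (1 + z * \<phi>'' z / \<phi>' z)"
    and boundary: "Re (1 + of_real \<rho> * \<phi>'' (of_real \<rho>) / \<phi>' (of_real \<rho>)) \<le> \<beta>"
  shows "convexity_radius \<beta> f = ereal \<rho>"
proof -
  define F where "F = fps_expansion f 0"
  have F: "F = fps_expansion \<phi> 0"
    unfolding F_def by (rule fps_expansion_cong) (rule f)
  have hol: "\<phi> holomorphic_on eball 0 (ereal C)"
    by (rule holomorphic_onI) (auto simp: field_differentiable_def intro: has_field_derivative_at_within d1)
  have conv: "ereal C \<le> fps_conv_radius F"
    unfolding F by (rule conv_radius_fps_expansion[OF hol])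
  have eval: "eval_fps F z = \<phi> z" if "norm z < C" for z
    using eval_fps_expansion'[OF hol, of z] that by (simp add: F)
  have near: "eventually (\<lambda>w. norm w < C) (nhds z)" if "norm z < C" for z :: complex
    using eventually_nhds_in_open[of "ball 0 C" z] that by (simp add: mem_ball_0)
  have 1: "deriv (eval_fps F) z = \<phi>' z" if "norm z < C" for z
  proof -
    have "deriv (eval_fps F) z = deriv \<phi> z"
      by (rule deriv_cong_ev[OF eventually_mono[OF near[OF that]] refl]) (rule eval)
    thus ?thesis using d1[OF that] by (simp add: DERIV_imp_deriv)
  qed
  have 2: "deriv (deriv (eval_fps F)) z = \<phi>'' z" if "norm z < C" for z
  proof -
    have "deriv (deriv (eval_fps F)) z = deriv \<phi>' z"
      by (rule deriv_cong_ev[OF eventually_mono[OF near[OF that]] refl]) (rule 1)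
    thus ?thesis using d2[OF that] by (simp add: DERIV_imp_deriv)
  qed
  have "Sup {ereal r |r. 0 < r \<and> ereal r < fps_conv_radius F \<and>
      (\<forall>z\<in>ball 0 r. deriv (eval_fps F) z \<noteq> 0 \<and>
          Re (1 + z * deriv (deriv (eval_fps F)) z / deriv (eval_fps F) z) > \<beta>)} = ereal \<rho>"
  proof (rule Sup_eqI)
    fix y assume "y \<in> {ereal r |r. 0 < r \<and> ereal r < fps_conv_radius F \<and>
      (\<forall>z\<in>ball 0 r. deriv (eval_fps F) z \<noteq> 0 \<and>
          Re (1 + z * deriv (deriv (eval_fps F)) z / deriv (eval_fps F) z) > \<beta>)}"
    then obtain r where r: "y = ereal r" 
      "\<And>z. norm z < r \<Longrightarrow> Re (1 + z * deriv (deriv (eval_fps F)) z / deriv (eval_fps F) z) > \<beta>"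
      by auto
    have "\<not> \<rho> < r"
    proof
      assume "\<rho> < r"
      hence "norm (complex_of_real \<rho>) < r" using \<rho> by simp
      from r(2)[OF this] boundary \<rho> show False by (simp add: 1 2)
    qed
    thus "y \<le> ereal \<rho>" using r by simp
  next
    fix y assume *: "\<And>x. x \<in> {ereal r |r. 0 < r \<and> ereal r < fps_conv_radius F \<and>
      (\<forall>z\<in>ball 0 r. deriv (eval_fps F) z \<noteq> 0 \<and>
          Re (1 + z * deriv (deriv (eval_fps F)) z / deriv (eval_fps F) z) > \<beta>)} \<Longrightarrow> x \<le> y"
    show "ereal \<rho> \<le> y"
    proof (rule *, rule CollectI, intro exI[of _ \<rho>] conjI ballI)
      show "ereal \<rho> = ereal \<rho>" by (rule refl)
      show "0 < \<rho>" by fact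
      have "ereal \<rho> < ereal C" using \<rho> by simp
      with conv show "ereal \<rho> < fps_conv_radius F" by (rule less_le_trans[rotated])
      fix z :: complex assume "z \<in> ball 0 \<rho>"
      hence z: "norm z < \<rho>" "norm z < C" using \<rho> by auto
      show "deriv (eval_fps F) z \<noteq> 0" using nz z by (simp add: 1)
      show "\<beta> < Re (1 + z * deriv (deriv (eval_fps F)) z / deriv (eval_fps F) z)"
        using inside[OF z(1)] z(2) by (simp only: 1 2)
    qed
  qed
  thus ?thesis by (simp add: convexity_radius_def Let_def F_def)
qed

lemma smallest_positive_rootI:
  "0 < r \<Longrightarrow> P r \<Longrightarrow> (\<And>s. 0 < s \<Longrightarrow> s < r \<Longrightarrow> \<not> P s) \<Longrightarrow> smallest_positive_root P r"
  unfolding smallest_positive_root_def by (meson not_le)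

section \<open>The normalized series expressed through \<open>bessel_fps\<close>\<close>

lemma normalized_bessel_0:
  assumes "\<nu> > -1" "\<nu> > real n - 1"
  shows "normalized_bessel \<nu> n 0 = 1"
proof -
  have "Gamma (\<nu> + 1) > 0" "Gamma (\<nu> - real n + 1) > 0"
    using assms by (auto intro!: Gamma_real_pos)
  moreover have "normalized_bessel \<nu> n 0 = (\<Sum>m\<in>{0::nat}. 
     of_real ((-1) ^ m * Gamma (2 * real m + \<nu> + 1) * Gamma (\<nu> - real n + 1)
              / (fact m * 4 ^ m * Gamma (2 * real m - real n + \<nu> + 1) * Gamma (real m + \<nu> + 1)))
            * 0 ^ (2 * m))"
    unfolding normalized_bessel_def by (intro suminf_finite) auto
  moreover have "2 * real 0 - real n + \<nu> + 1 = \<nu> - real n + 1" "2 * real 0 + \<nu> + 1 = \<nu> + 1" "real 0 + \<nu> + 1 = \<nu> + 1"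
    by simp_all
  ultimately show ?thesis by (simp del: of_real_mult of_real_divide)
qed

text \<open>Each application of \<open>bessel_op\<close> multiplies the constant coefficient by
  \<open>\<nu> - n\<close>, which is exactly the factor that the functional equation of
  \<open>Gamma\<close> removes.\<close>

lemma bessel_fps_nth_0:
  assumes "\<nu> > -1" "\<nu> > real n - 1"
  shows "of_real (2 powr \<nu> * Gamma (\<nu> - real n + 1)) * fps_nth (bessel_fps \<nu> n) 0 = 1"
  using assms(2)
proof (induction n)
  case 0
  have "Gamma (\<nu> + 1) > 0" using assms by (intro Gamma_real_pos) auto
  thus ?case by (simp add: bessel_fps_def)
next
  case (Suc n)
  have p: "\<nu> - real n > 0" using Suc by simp
  hence "\<nu> - real n \<notin> \<int>\<^sub>\<le>\<^sub>0" by (auto elim!: nonpos_Ints_cases)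
  from Gamma_plus1[OF this] have G: "Gamma (\<nu> - real n + 1) = (\<nu> - real n) * Gamma (\<nu> - real (Suc n) + 1)"
    by (simp add: algebra_simps)
  have "of_real (2 powr \<nu> * Gamma (\<nu> - real (Suc n) + 1)) * fps_nth (bessel_fps \<nu> (Suc n)) 0
      = of_real (2 powr \<nu> * ((\<nu> - real n) * Gamma (\<nu> - real (Suc n) + 1))) * fps_nth (bessel_fps \<nu> n) 0"
    unfolding bessel_fps_Suc_eq_bessel_op bessel_op_0 by (simp add: mult_ac del: of_real_diff)
  also have "\<dots> = 1" unfolding G[symmetric] using Suc by simp
  finally show ?case .
qed

text \<open>The series depends on the square of its argument only, so every nonzero argument may be moved
  off the branch cut.\<close>

lemma normalized_bessel_eq_eval:
  assumes "\<nu> > -1" "\<nu> > real n - 1"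
  shows "normalized_bessel \<nu> n z =
    of_real (2 powr \<nu> * Gamma (\<nu> - real n + 1)) * eval_fps (bessel_fps \<nu> n) (z ^ 2)"
proof (cases "z = 0")
  case True
  thus ?thesis using normalized_bessel_0[OF assms] bessel_fps_nth_0[OF assms]
    by (simp add: eval_fps_at_0)
next
  case False
  define w where "w = csqrt (z ^ 2)"
  have w2: "w ^ 2 = z ^ 2" by (simp add: w_def)
  have w0: "w \<noteq> 0" using False by (auto simp: w_def)
  have w: "w \<notin> \<real>\<^sub>\<le>\<^sub>0"
  proof
    assume "w \<in> \<real>\<^sub>\<le>\<^sub>0"
    hence "Re w \<le> 0" "Im w = 0" by (auto simp: complex_nonpos_Reals_iff)
    moreover have "0 \<le> Re w" using csqrt_principal[of "z ^ 2"] by (auto simp: w_def)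
    ultimately show False using w0 by (simp add: complex_eq_iff)
  qed
  have "normalized_bessel \<nu> n z = normalized_bessel \<nu> n w"
    unfolding normalized_bessel_def power_mult w2 ..
  also have "\<dots> = of_real (2 powr \<nu> * Gamma (\<nu> - real n + 1)) *
      (w powr of_real (real n - \<nu>) * w powr of_real (\<nu> - real n)) * eval_fps (bessel_fps \<nu> n) (w ^ 2)"
    by (simp only: normalized_bessel_eq[OF assms(2) w] bessel_J_deriv_eq_fps[OF assms(1) w] mult.assoc)
  also have "w powr of_real (real n - \<nu>) * w powr of_real (\<nu> - real n) = 1"
    using w0 by (simp flip: powr_add)
  finally show ?thesis by (simp only: w2 mult_1_right)
qed

text \<open>Both operators are polynomials in the Euler operator \<open>w * d/dw\<close>. The lemma
  exchanges the passage to the next derivative with the operator that belongs to \<open>g\<close> or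
  \<open>h\<close>.\<close>

lemma bessel_op_commute: "bessel_op c (bessel_op d P) = bessel_op d (bessel_op c P)"
  by (simp add: bessel_op_def algebra_simps)

section \<open>Bessel quotients at positive real arguments\<close>

lemma bessel_J_deriv_real:
  assumes "\<nu> > -1" "0 < s"
  shows "bessel_J_deriv \<nu> n (of_real s) = of_real s powr of_real (\<nu> - real n) * eval_fps (bessel_fps \<nu> n) (of_real (s ^ 2))"
  using bessel_J_deriv_eq_fps[OF assms(1), of "of_real s" n] assms(2) by simp

lemma powr_of_real_Suc:
  fixes z :: complex
  assumes "z \<noteq> 0"
  shows "z powr of_real (\<nu> - real n) = z * z powr of_real (\<nu> - real (Suc n))"
proof -
  have "complex_of_real (\<nu> - real n) = of_real (\<nu> - real (Suc n)) + 1" by simp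
  thus ?thesis using assms by (simp only: powr_add powr_one') simp
qed

context
  fixes \<nu> s :: real and n :: nat and w :: complex
  assumes \<nu>: "\<nu> > -1" and s: "0 < s"
  defines "w \<equiv> of_real (s ^ 2)"
begin

lemma bessel_J_deriv_Suc_real:
  "of_real s * bessel_J_deriv \<nu> (Suc n) (of_real s)
     = of_real s powr of_real (\<nu> - real n) * eval_fps (bessel_op (\<nu> - real n) (bessel_fps \<nu> n)) w"
proof -
  have "complex_of_real s \<noteq> 0" using s by simp
  from powr_of_real_Suc[OF this, of \<nu> n] show ?thesis
    by (simp only: bessel_J_deriv_real[OF \<nu> s] bessel_fps_Suc_eq_bessel_op w_def mult_ac)
qed

text \<open>The next derivative contributes \<open>(\<nu> - n) * B + 2 * w * B'\<close>, and the
  coefficient \<open>n - \<nu> + c\<close> replaces \<open>\<nu> - n\<close> by \<open>c\<close>.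
  The values \<open>c = 1\<close> and \<open>c = 2\<close> give the denominators for
  \<open>g\<close> and \<open>h\<close>.\<close>

lemma bessel_J_denominator:
  "of_real (real n - \<nu> + c) * bessel_J_deriv \<nu> n (of_real s) + of_real s * bessel_J_deriv \<nu> (n + 1) (of_real s)
     = of_real s powr of_real (\<nu> - real n) * eval_fps (bessel_op c (bessel_fps \<nu> n)) w"
proof -
  define p where "p = complex_of_real s powr of_real (\<nu> - real n)"
  have 1: "bessel_J_deriv \<nu> n (of_real s) = p * eval_fps (bessel_fps \<nu> n) w"
    unfolding p_def w_def by (rule bessel_J_deriv_real[OF \<nu> s])
  have 2: "of_real s * bessel_J_deriv \<nu> (n + 1) (of_real s)
     = p * eval_fps (bessel_op (\<nu> - real n) (bessel_fps \<nu> n)) w"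
    using bessel_J_deriv_Suc_real by (simp add: p_def)
  show ?thesis
    unfolding 1 2 p_def[symmetric] eval_bessel_op[OF bessel_fps_conv_radius[OF \<nu>]]
    by (simp add: algebra_simps)
qed

end

context
  fixes \<nu> s :: real and n :: nat and w :: complex
  assumes \<nu>: "\<nu> > -1" and s: "0 < s"
  defines "w \<equiv> of_real (s ^ 2)"
begin

text \<open>The left side is \<open>s\<close> times the derivative of the denominator above, which
  explains the shift from \<open>c\<close> to \<open>c + 1\<close>. The proof needs the earlier
  identities at order \<open>Suc n\<close> too, so they are taken from a context that has already
  been closed.\<close>

lemma bessel_J_numerator:
  "of_real (real n - \<nu> + (c + 1)) * of_real s * bessel_J_deriv \<nu> (n + 1) (of_real s)
     + of_real s ^ 2 * bessel_J_deriv \<nu> (n + 2) (of_real s)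
   = of_real s powr of_real (\<nu> - real n) *
       (of_real (\<nu> - real n) * eval_fps (bessel_op c (bessel_fps \<nu> n)) w
        + 2 * w * eval_fps (fps_deriv (bessel_op c (bessel_fps \<nu> n))) w)"
proof -
  define p where "p = complex_of_real s powr of_real (\<nu> - real n)"
  define B where "B = bessel_fps \<nu> n"
  define B1 where "B1 = bessel_fps \<nu> (Suc n)"
  have [simp]: "fps_conv_radius B = \<infinity>" "fps_conv_radius B1 = \<infinity>"
    by (simp_all add: B_def B1_def bessel_fps_conv_radius[OF \<nu>])
  have p: "of_real s * complex_of_real s powr of_real (\<nu> - real (Suc n)) = p"
    using s powr_of_real_Suc[of "of_real s" \<nu> n] by (simp only: p_def of_real_eq_0_iff)
  have 1: "of_real s * bessel_J_deriv \<nu> (n + 1) (of_real s) = p * eval_fps B1 w"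
    using bessel_J_deriv_Suc_real[OF \<nu> s, of n]
    by (simp add: p_def B1_def bessel_fps_Suc_eq_bessel_op w_def)
  have "of_real s ^ 2 * bessel_J_deriv \<nu> (n + 2) (of_real s)
      = of_real s * (of_real s * bessel_J_deriv \<nu> (Suc (Suc n)) (of_real s))"
    by (simp add: power2_eq_square)
  also have "\<dots> = p * eval_fps (bessel_op (\<nu> - real (Suc n)) B1) w"
    unfolding bessel_J_deriv_Suc_real[OF \<nu> s] p[symmetric] B1_def w_def by (simp only: mult.assoc)
  finally have 2: "of_real s ^ 2 * bessel_J_deriv \<nu> (n + 2) (of_real s)
      = p * eval_fps (bessel_op (\<nu> - real (Suc n)) B1) w" .
  have "of_real (real n - \<nu> + (c + 1)) * of_real s * bessel_J_deriv \<nu> (n + 1) (of_real s)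
     + of_real s ^ 2 * bessel_J_deriv \<nu> (n + 2) (of_real s) = p * eval_fps (bessel_op c B1) w"
    unfolding mult.assoc 1 2 by (simp add: eval_bessel_op algebra_simps)
  also have "bessel_op c B1 = bessel_op (\<nu> - real n) (bessel_op c B)"
    unfolding B1_def B_def bessel_fps_Suc_eq_bessel_op by (rule bessel_op_commute)
  finally show ?thesis
    by (simp add: eval_bessel_op fps_conv_radius_bessel_op p_def B_def[symmetric])
qed

lemma bessel_J_quotient:
  assumes "eval_fps (bessel_op c (bessel_fps \<nu> n)) w \<noteq> 0"
  shows "(of_real (real n - \<nu> + (c + 1)) * of_real s * bessel_J_deriv \<nu> (n + 1) (of_real s)
       + of_real s ^ 2 * bessel_J_deriv \<nu> (n + 2) (of_real s))
     / (of_real (real n - \<nu> + c) * bessel_J_deriv \<nu> n (of_real s) + of_real s * bessel_J_deriv \<nu> (n + 1) (of_real s))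
   = of_real (\<nu> - real n) + 2 * w * eval_fps (fps_deriv (bessel_op c (bessel_fps \<nu> n))) w
        / eval_fps (bessel_op c (bessel_fps \<nu> n)) w"
  unfolding bessel_J_numerator bessel_J_denominator[OF \<nu> s] w_def[symmetric]
  using assms s by (simp add: field_simps)

lemma bessel_J_denominator_nonzero:
  assumes "eval_fps (bessel_op c (bessel_fps \<nu> n)) w \<noteq> 0"
  shows "of_real (real n - \<nu> + c) * bessel_J_deriv \<nu> n (of_real s)
           + of_real s * bessel_J_deriv \<nu> (n + 1) (of_real s) \<noteq> 0"
  unfolding bessel_J_denominator[OF \<nu> s] using assms s by (simp add: w_def)

lemma bessel_J_deriv_eq_0_iff: "bessel_J_deriv \<nu> n (of_real s) = 0 \<longleftrightarrow> eval_fps (bessel_fps \<nu> n) w = 0"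
  unfolding bessel_J_deriv_real[OF \<nu> s] using s by (simp add: w_def)

lemma bessel_J_logderiv:
  assumes "eval_fps (bessel_fps \<nu> n) w \<noteq> 0"
  shows "of_real s * bessel_J_deriv \<nu> (Suc n) (of_real s) / bessel_J_deriv \<nu> n (of_real s)
    = of_real (\<nu> - real n) + 2 * w * eval_fps (fps_deriv (bessel_fps \<nu> n)) w / eval_fps (bessel_fps \<nu> n) w"
proof -
  have "complex_of_real s powr of_real (\<nu> - real n) \<noteq> 0" using s by simp
  thus ?thesis
    unfolding bessel_J_deriv_Suc_real[OF \<nu> s]
    unfolding bessel_J_deriv_real[OF \<nu> s] w_def[symmetric]
      eval_bessel_op[OF bessel_fps_conv_radius[OF \<nu>]]
    using assms by (simp add: field_simps del: of_real_diff)
qed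

end

section \<open>First positive zeros and smallest roots\<close>

lemma bessel_zero_first:
  assumes x: "0 < x" "bessel_J_deriv \<nu> n (of_real x) = 0"
    and nz: "\<And>y. 0 < y \<Longrightarrow> y < x \<Longrightarrow> bessel_J_deriv \<nu> n (of_real y) \<noteq> 0"
  shows "bessel_zero \<nu> n 1 = x"
  unfolding bessel_zero_def
proof (rule the_equality)
  have "{y. 0 < y \<and> y \<le> x \<and> bessel_J_deriv \<nu> n (of_real y) = 0} = {x}"
    using x nz by (force simp: not_less)
  thus "0 < x \<and> bessel_J_deriv \<nu> n (of_real x) = 0 \<and>
      card {y. 0 < y \<and> y \<le> x \<and> bessel_J_deriv \<nu> n (of_real y) = 0} = 1"
    using x by simp
next
  fix x' assume x': "0 < x' \<and> bessel_J_deriv \<nu> n (of_real x') = 0 \<and>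
      card {y. 0 < y \<and> y \<le> x' \<and> bessel_J_deriv \<nu> n (of_real y) = 0} = 1"
  hence "x \<le> x'" using nz by (meson not_le)
  from x' obtain a where a: "{y. 0 < y \<and> y \<le> x' \<and> bessel_J_deriv \<nu> n (of_real y) = 0} = {a}"
    using card_1_singletonE by metis
  \<comment> \<open>Both zeros are counted in the set for \<open>x'\<close>, which has one
    element.\<close>
  have "x \<in> {a}" "x' \<in> {a}" unfolding a[symmetric] using x x' \<open>x \<le> x'\<close> by auto
  thus "x' = x" by simp
qed

lemma power2_less_of_less_sqrt: "0 \<le> y \<Longrightarrow> y < sqrt x \<Longrightarrow> y ^ 2 < x"
  by (metis less_eq_real_def linorder_not_less real_le_lsqrt real_sqrt_le_0_iff order_trans order_less_le_trans)

text \<open>In the variable \<open>w\<close> the radius \<open>R\<close> is itself a zero of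
  \<open>bessel_fps \<nu> n\<close>, and there is none of smaller norm; the square root comes from
  \<open>w = z^2\<close>.\<close>

lemma bessel_zero_first_eq_radius:
  assumes "\<nu> > -1" "\<nu> > real n - 1" "fps_conv_radius (neg_logderiv (bessel_fps \<nu> n)) = ereal R"
  shows "bessel_zero \<nu> n 1 = sqrt R"
proof (rule bessel_zero_first)
  have P: "rayleigh_class (bessel_fps \<nu> n)" by (intro rayleigh_class_bessel_fps assms)
  hence Pc: "fps_conv_radius (bessel_fps \<nu> n) = \<infinity>" "fps_nth (bessel_fps \<nu> n) 0 \<noteq> 0"
    by (auto simp: rayleigh_class_def)
  have R: "0 < R" "eval_fps (bessel_fps \<nu> n) (of_real R) = 0"
    using rayleigh_class_radius[OF P] assms(3) by (metis ereal.inject)+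
  show "0 < sqrt R" using R by simp
  thus "bessel_J_deriv \<nu> n (of_real (sqrt R)) = 0"
    using R by (simp add: bessel_J_deriv_eq_0_iff[OF assms(1)] flip: of_real_power)
  fix y assume y: "0 < y" "y < sqrt R"
  have "y ^ 2 < R" using y by (simp add: power2_less_of_less_sqrt)
  hence "eval_fps (bessel_fps \<nu> n) (of_real (y ^ 2)) \<noteq> 0"
    by (intro eval_nonzero[OF Pc]) (simp add: assms(3) norm_power)
  thus "bessel_J_deriv \<nu> n (of_real y) \<noteq> 0"
    using bessel_J_deriv_eq_0_iff[OF assms(1) y(1)] by simp
qed

text \<open>The equivalence is demanded only up to \<open>\<rho>\<close>, where the denominators are
  known not to vanish; larger roots cannot affect minimality.\<close>

lemma smallest_positive_root_levelI:
  fixes G :: "real \<Rightarrow> complex"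
  assumes "0 < \<rho>" and iff: "\<And>r. 0 < r \<Longrightarrow> r \<le> \<rho> \<Longrightarrow> P r \<longleftrightarrow> G r = of_real b"
    and "G \<rho> = of_real b" and less: "\<And>r. 0 < r \<Longrightarrow> r < \<rho> \<Longrightarrow> Re (G r) < b"
  shows "smallest_positive_root P \<rho>"
proof (rule smallest_positive_rootI)
  show "0 < \<rho>" by fact
  show "P \<rho>" using assms by simp
  fix s assume s: "0 < s" "s < \<rho>"
  show "\<not> P s" using less[OF s] iff[of s] s by auto
qed

text \<open>Here \<open>g = \<kappa> * z * B(z^2)\<close> and \<open>g' = \<kappa> * Q(z^2)\<close>
  with \<open>Q = bessel_op 1 B\<close>. The convexity quotient is \<open>1 - 2 * w * S w\<close>
  with \<open>w = z^2\<close>, so the critical level for \<open>w * S w\<close> is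
  \<open>(1 - \<beta>) / 2\<close> and the radius is the square root of the level point.\<close>

lemma convexity_radius_bessel_g:
  assumes \<beta>: "\<beta> < 1" and \<nu>: "\<nu> > -1" "\<nu> > real n - 1"
  shows "\<exists>\<rho>. convexity_radius \<beta> (bessel_g \<nu> n) = ereal \<rho> \<and>
          smallest_positive_root
            (\<lambda>r. of_real (real n - \<nu> + 1) * bessel_J_deriv \<nu> n (of_real r)
                   + of_real r * bessel_J_deriv \<nu> (n + 1) (of_real r) \<noteq> 0 \<and>
                 of_real (real n + 1 - \<nu> - \<beta>)
                 + (of_real (real n - \<nu> + 2) * of_real r * bessel_J_deriv \<nu> (n + 1) (of_real r)
                     + of_real r ^ 2 * bessel_J_deriv \<nu> (n + 2) (of_real r))
                   / (of_real (real n - \<nu> + 1) * bessel_J_deriv \<nu> n (of_real r)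
                     + of_real r * bessel_J_deriv \<nu> (n + 1) (of_real r)) = 0) \<rho>"
    (is "\<exists>\<rho>. _ \<and> smallest_positive_root ?P \<rho>")
proof -
  define B where "B = bessel_fps \<nu> n"
  define Q where "Q = bessel_op 1 B"
  define S where "S = neg_logderiv Q"
  define \<kappa> where "\<kappa> = complex_of_real (2 powr \<nu> * Gamma (\<nu> - real n + 1))"
  have B: "fps_conv_radius B = \<infinity>" by (simp add: B_def bessel_fps_conv_radius \<nu>)
  have Q: "rayleigh_class Q"
    unfolding Q_def B_def by (intro rayleigh_class_bessel_op rayleigh_class_bessel_fps \<nu>) simp
  hence Qc: "fps_conv_radius Q = \<infinity>" "fps_nth Q 0 \<noteq> 0" by (auto simp: rayleigh_class_def)
  have "(1 - \<beta>) / 2 > 0" using \<beta> by simp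
  then obtain x R where R: "fps_conv_radius S = ereal R" and x: "0 < x" "x < R"
    "of_real x * eval_fps S (of_real x) = of_real ((1 - \<beta>) / 2)"
    "\<And>w. norm w < x \<Longrightarrow> Re (w * eval_fps S w) < (1 - \<beta>) / 2"
    using rayleigh_class_level_point[OF Q] unfolding S_def by blast
  define \<rho> where "\<rho> = sqrt x"
  have \<rho>: "0 < \<rho>" "\<rho> ^ 2 = x" using x by (auto simp: \<rho>_def)
  have nz: "eval_fps Q w \<noteq> 0" and Sw: "2 * w * eval_fps (fps_deriv Q) w / eval_fps Q w = - 2 * (w * eval_fps S w)"
    if "norm w \<le> x" for w
  proof -
    have w: "ereal (norm w) < fps_conv_radius (neg_logderiv Q)" using that x R by (simp add: S_def)
    show "eval_fps Q w \<noteq> 0" by (rule eval_nonzero[OF Qc w])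
    show "2 * w * eval_fps (fps_deriv Q) w / eval_fps Q w = - 2 * (w * eval_fps S w)"
      using eval_neg_logderiv[OF Qc w] by (simp add: S_def)
  qed
  have "Gamma (\<nu> - real n + 1) > 0" using \<nu> by (intro Gamma_real_pos) auto
  hence \<kappa>: "\<kappa> \<noteq> 0" by (simp add: \<kappa>_def)
  have "convexity_radius \<beta> (bessel_g \<nu> n) = ereal \<rho>"
  \<comment> \<open>Any \<open>C > \<rho>\<close> would do, since \<open>\<phi>\<close> is
    entire.\<close>
  proof (rule convexity_radius_eqI[where C = "\<rho> + 1" and \<phi> = "\<lambda>z. \<kappa> * (z * eval_fps B (z ^ 2))"
        and \<phi>' = "\<lambda>z. \<kappa> * eval_fps Q (z ^ 2)" and \<phi>'' = "\<lambda>z. \<kappa> * (2 * z * eval_fps (fps_deriv Q) (z ^ 2))"])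
    show "0 < \<rho>" "\<rho> < \<rho> + 1" using \<rho> by auto
    show "\<forall>\<^sub>F z in nhds 0. bessel_g \<nu> n z = \<kappa> * (z * eval_fps B (z ^ 2))"
      unfolding bessel_g_def normalized_bessel_eq_eval[OF \<nu>] by (simp add: \<kappa>_def B_def mult_ac)
    fix z :: complex
    have "((\<lambda>z. eval_fps B (z ^ 2)) has_field_derivative eval_fps (fps_deriv B) (z ^ 2) * (2 * z)) (at z)"
      by (rule DERIV_chain2[OF has_field_derivative_eval_fps]) (auto simp: B intro!: derivative_eq_intros)
    from DERIV_cmult[OF DERIV_mult[OF DERIV_ident this], of \<kappa>]
    show "((\<lambda>z. \<kappa> * (z * eval_fps B (z ^ 2))) has_field_derivative \<kappa> * eval_fps Q (z ^ 2)) (at z)"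
      by (simp add: Q_def eval_bessel_op[OF B] power2_eq_square algebra_simps)
    have "((\<lambda>z. eval_fps Q (z ^ 2)) has_field_derivative eval_fps (fps_deriv Q) (z ^ 2) * (2 * z)) (at z)"
      by (rule DERIV_chain2[OF has_field_derivative_eval_fps]) (auto simp: Qc intro!: derivative_eq_intros)
    from DERIV_cmult[OF this, of \<kappa>]
    show "((\<lambda>z. \<kappa> * eval_fps Q (z ^ 2)) has_field_derivative \<kappa> * (2 * z * eval_fps (fps_deriv Q) (z ^ 2))) (at z)"
      by (simp add: mult_ac)
  next
    have *: "1 + z * (\<kappa> * (2 * z * eval_fps (fps_deriv Q) (z ^ 2))) / (\<kappa> * eval_fps Q (z ^ 2))
       = 1 - 2 * (z ^ 2 * eval_fps S (z ^ 2))" if "norm z \<le> \<rho>" for z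
    proof -
      have "norm (z ^ 2) \<le> x" using that \<rho> by (metis norm_ge_zero norm_power power_mono)
      from Sw[OF this] show ?thesis using \<kappa> by (simp add: power2_eq_square mult_ac)
    qed
    show "Re (1 + of_real \<rho> * (\<kappa> * (2 * of_real \<rho> * eval_fps (fps_deriv Q) (of_real \<rho> ^ 2))) / (\<kappa> * eval_fps Q (of_real \<rho> ^ 2))) \<le> \<beta>"
      using \<rho> by (subst *) (simp_all add: x(3) diff_divide_distrib flip: of_real_power)
    fix z :: complex assume z: "norm z < \<rho>"
    hence z2: "norm (z ^ 2) < x"
      using \<rho> by (metis norm_ge_zero norm_power power_strict_mono zero_less_numeral)
    thus "\<kappa> * eval_fps Q (z ^ 2) \<noteq> 0" using \<kappa> nz[of "z ^ 2"] by simp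
    show "\<beta> < Re (1 + z * (\<kappa> * (2 * z * eval_fps (fps_deriv Q) (z ^ 2))) / (\<kappa> * eval_fps Q (z ^ 2)))"
      using z x(4)[OF z2] by (subst *) (auto simp: field_simps)
  qed
  moreover have "smallest_positive_root ?P \<rho>"
  proof (rule smallest_positive_root_levelI[where G = "\<lambda>r. of_real (r ^ 2) * eval_fps S (of_real (r ^ 2))"])
    show "0 < \<rho>" by fact
    show "of_real (\<rho> ^ 2) * eval_fps S (of_real (\<rho> ^ 2)) = of_real ((1 - \<beta>) / 2)"
      using \<rho> x(3) by simp
  next
    fix r assume r: "0 < r" "r < \<rho>"
    have "norm (complex_of_real (r ^ 2)) < x"
      using r \<rho> by (simp add: norm_power power_strict_mono flip: \<rho>(2))
    thus "Re (of_real (r ^ 2) * eval_fps S (of_real (r ^ 2))) < (1 - \<beta>) / 2" by (rule x(4))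
  next
    fix r assume r: "0 < r" "r \<le> \<rho>"
    have le: "norm (complex_of_real (r ^ 2)) \<le> x"
      using r \<rho> by (simp add: norm_power power_mono flip: \<rho>(2))
    note Q0 = nz[OF le, unfolded Q_def B_def]
    \<comment> \<open>The quotient contributes \<open>\<nu> - n\<close>, which reduces the constant
      \<open>n + 1 - \<nu> - \<beta>\<close> to \<open>1 - \<beta>\<close>.\<close>
    have "?P r \<longleftrightarrow> of_real (real n + 1 - \<nu> - \<beta>)
        + (of_real (\<nu> - real n) - 2 * (of_real (r ^ 2) * eval_fps S (of_real (r ^ 2)))) = 0"
      using bessel_J_quotient[OF \<nu>(1) r(1) Q0, unfolded one_add_one, folded B_def Q_def]
        bessel_J_denominator_nonzero[OF \<nu>(1) r(1) Q0] Sw[OF le] by (simp only: simp_thms) simp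
    also have "\<dots> \<longleftrightarrow> of_real (r ^ 2) * eval_fps S (of_real (r ^ 2)) = complex_of_real ((1 - \<beta>) / 2)"
      by (auto simp: field_simps)
    finally show "?P r \<longleftrightarrow> of_real (r ^ 2) * eval_fps S (of_real (r ^ 2)) = complex_of_real ((1 - \<beta>) / 2)" .
  qed
  ultimately show ?thesis by blast
qed

subsection \<open>The three normalizations\<close>

text \<open>Since \<open>csqrt z\<close> squares to \<open>z\<close>, here
  \<open>h = \<kappa> * z * B z\<close>. The factor 1/2 in the derivative appears because
  \<open>bessel_op 2 B\<close> is \<open>2 * (B + w * B')\<close>. The critical level is
  \<open>1 - \<beta>\<close>, and the level point itself is the radius.\<close>

lemma convexity_radius_bessel_h:
  assumes \<beta>: "\<beta> < 1" and \<nu>: "\<nu> > -1" "\<nu> > real n - 1"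
  shows "\<exists>\<rho>. convexity_radius \<beta> (bessel_h \<nu> n) = ereal \<rho> \<and>
          smallest_positive_root
            (\<lambda>r. of_real (real n - \<nu> + 2) * bessel_J_deriv \<nu> n (of_real (sqrt r))
                   + of_real (sqrt r) * bessel_J_deriv \<nu> (n + 1) (of_real (sqrt r)) \<noteq> 0 \<and>
                 of_real ((real n + 2 - \<nu> - 2 * \<beta>) / 2)
                 + of_real (sqrt r) / 2
                   * ((of_real (real n - \<nu> + 3) * bessel_J_deriv \<nu> (n + 1) (of_real (sqrt r))
                        + of_real (sqrt r) * bessel_J_deriv \<nu> (n + 2) (of_real (sqrt r)))
                      / (of_real (real n - \<nu> + 2) * bessel_J_deriv \<nu> n (of_real (sqrt r))
                        + of_real (sqrt r) * bessel_J_deriv \<nu> (n + 1) (of_real (sqrt r)))) = 0) \<rho>"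
    (is "\<exists>\<rho>. _ \<and> smallest_positive_root ?P \<rho>")
proof -
  define B where "B = bessel_fps \<nu> n"
  define Q where "Q = bessel_op 2 B"
  define S where "S = neg_logderiv Q"
  define \<kappa> where "\<kappa> = complex_of_real (2 powr \<nu> * Gamma (\<nu> - real n + 1))"
  have B: "fps_conv_radius B = \<infinity>" by (simp add: B_def bessel_fps_conv_radius \<nu>)
  have Q: "rayleigh_class Q"
    unfolding Q_def B_def by (intro rayleigh_class_bessel_op rayleigh_class_bessel_fps \<nu>) simp
  hence Qc: "fps_conv_radius Q = \<infinity>" "fps_nth Q 0 \<noteq> 0" by (auto simp: rayleigh_class_def)
  have "1 - \<beta> > 0" using \<beta> by simp
  then obtain x R where R: "fps_conv_radius S = ereal R" and x: "0 < x" "x < R"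
    "of_real x * eval_fps S (of_real x) = of_real (1 - \<beta>)"
    "\<And>w. norm w < x \<Longrightarrow> Re (w * eval_fps S w) < 1 - \<beta>"
    using rayleigh_class_level_point[OF Q] unfolding S_def by blast
  have nz: "eval_fps Q w \<noteq> 0" and Sw: "w * eval_fps (fps_deriv Q) w / eval_fps Q w = - (w * eval_fps S w)"
    if "norm w \<le> x" for w
  proof -
    have w: "ereal (norm w) < fps_conv_radius (neg_logderiv Q)" using that x R by (simp add: S_def)
    show "eval_fps Q w \<noteq> 0" by (rule eval_nonzero[OF Qc w])
    show "w * eval_fps (fps_deriv Q) w / eval_fps Q w = - (w * eval_fps S w)"
      using eval_neg_logderiv[OF Qc w] by (simp add: S_def)
  qed
  have "Gamma (\<nu> - real n + 1) > 0" using \<nu> by (intro Gamma_real_pos) auto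
  hence \<kappa>: "\<kappa> \<noteq> 0" by (simp add: \<kappa>_def)
  have "convexity_radius \<beta> (bessel_h \<nu> n) = ereal x"
  proof (rule convexity_radius_eqI[where C = "x + 1" and \<phi> = "\<lambda>z. \<kappa> * (z * eval_fps B z)"
        and \<phi>' = "\<lambda>z. \<kappa> / 2 * eval_fps Q z" and \<phi>'' = "\<lambda>z. \<kappa> / 2 * eval_fps (fps_deriv Q) z"])
    show "0 < x" "x < x + 1" using x by auto
    show "\<forall>\<^sub>F z in nhds 0. bessel_h \<nu> n z = \<kappa> * (z * eval_fps B z)"
      unfolding bessel_h_def normalized_bessel_eq_eval[OF \<nu>] by (simp add: \<kappa>_def B_def mult_ac)
    fix z :: complex
    have "(eval_fps B has_field_derivative eval_fps (fps_deriv B) z) (at z)"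
      by (rule has_field_derivative_eval_fps) (simp add: B)
    from DERIV_cmult[OF DERIV_mult[OF DERIV_ident this], of \<kappa>]
    show "((\<lambda>z. \<kappa> * (z * eval_fps B z)) has_field_derivative \<kappa> / 2 * eval_fps Q z) (at z)"
      by (simp add: Q_def eval_bessel_op[OF B] algebra_simps)
    show "((\<lambda>z. \<kappa> / 2 * eval_fps Q z) has_field_derivative \<kappa> / 2 * eval_fps (fps_deriv Q) z) (at z)"
      by (intro DERIV_cmult has_field_derivative_eval_fps) (simp add: Qc)
  next
    have *: "1 + z * (\<kappa> / 2 * eval_fps (fps_deriv Q) z) / (\<kappa> / 2 * eval_fps Q z) = 1 - z * eval_fps S z"
      if "norm z \<le> x" for z
      using Sw[OF that] \<kappa> by simp
    show "Re (1 + of_real x * (\<kappa> / 2 * eval_fps (fps_deriv Q) (of_real x)) / (\<kappa> / 2 * eval_fps Q (of_real x))) \<le> \<beta>"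
      using x(1) by (subst *) (simp_all add: x(3))
    fix z :: complex assume z: "norm z < x"
    thus "\<kappa> / 2 * eval_fps Q z \<noteq> 0" using \<kappa> nz[of z] by simp
    show "\<beta> < Re (1 + z * (\<kappa> / 2 * eval_fps (fps_deriv Q) z) / (\<kappa> / 2 * eval_fps Q z))"
      using z x(4)[OF z] by (subst *) auto
  qed
  moreover have "smallest_positive_root ?P x"
  proof (rule smallest_positive_root_levelI[where G = "\<lambda>r. of_real r * eval_fps S (of_real r)"])
    show "0 < x" "of_real x * eval_fps S (of_real x) = of_real (1 - \<beta>)" by fact+
  next
    fix r assume "0 < r" "r < x"
    thus "Re (of_real r * eval_fps S (of_real r)) < 1 - \<beta>" by (intro x(4)) simp
  next
    fix r assume r: "0 < r" "r \<le> x"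
    \<comment> \<open>The quotient identity is applied at the argument \<open>s\<close>, for which
      its variable \<open>w\<close> is \<open>r\<close>.\<close>
    define s where "s = sqrt r"
    have s: "0 < s" and s2: "s ^ 2 = r" using r by (auto simp: s_def)
    have le: "norm (complex_of_real r) \<le> x" using r by simp
    note Q0 = nz[OF le, unfolded Q_def B_def, folded s2]
    define N where "N = of_real (real n - \<nu> + 3) * bessel_J_deriv \<nu> (n + 1) (of_real s)
                        + of_real s * bessel_J_deriv \<nu> (n + 2) (of_real s)"
    define D where "D = of_real (real n - \<nu> + 2) * bessel_J_deriv \<nu> n (of_real s)
                        + of_real s * bessel_J_deriv \<nu> (n + 1) (of_real s)"
    have D0: "D \<noteq> 0" unfolding D_def by (rule bessel_J_denominator_nonzero[OF \<nu>(1) s Q0])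
    have "of_real s * N / D = of_real (\<nu> - real n) + 2 * (of_real r * eval_fps (fps_deriv Q) (of_real r) / eval_fps Q (of_real r))"
    proof -
      have "of_real s * N = of_real (real n - \<nu> + (2 + 1)) * of_real s * bessel_J_deriv \<nu> (n + 1) (of_real s)
               + of_real s ^ 2 * bessel_J_deriv \<nu> (n + 2) (of_real s)"
        by (simp add: N_def algebra_simps power2_eq_square)
      hence "of_real s * N / D = of_real (\<nu> - real n) + 2 * of_real r * eval_fps (fps_deriv Q) (of_real r) / eval_fps Q (of_real r)"
        using bessel_J_quotient[OF \<nu>(1) s Q0] by (simp only: D_def s2 B_def Q_def)
      thus ?thesis by simp
    qed
    hence "of_real s / 2 * (N / D) = of_real ((\<nu> - real n) / 2) - of_real r * eval_fps S (of_real r)"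
      unfolding Sw[OF le] by (simp add: field_simps)
    hence "?P r \<longleftrightarrow> of_real ((real n + 2 - \<nu> - 2 * \<beta>) / 2)
        + (of_real ((\<nu> - real n) / 2) - of_real r * eval_fps S (of_real r)) = 0"
      using D0 unfolding N_def D_def s_def by (simp only: simp_thms)
    also have "of_real ((real n + 2 - \<nu> - 2 * \<beta>) / 2) + (of_real ((\<nu> - real n) / 2) - of_real r * eval_fps S (of_real r))
        = complex_of_real ((real n + 2 - \<nu> - 2 * \<beta>) / 2 + (\<nu> - real n) / 2) - of_real r * eval_fps S (of_real r)"
      by simp
    also have "(real n + 2 - \<nu> - 2 * \<beta>) / 2 + (\<nu> - real n) / 2 = 1 - \<beta>" by (simp add: field_simps)
    also have "complex_of_real (1 - \<beta>) - of_real r * eval_fps S (of_real r) = 0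
        \<longleftrightarrow> of_real r * eval_fps S (of_real r) = complex_of_real (1 - \<beta>)" by auto
    finally show "?P r \<longleftrightarrow> of_real r * eval_fps S (of_real r) = complex_of_real (1 - \<beta>)" .
  qed
  ultimately show ?thesis by blast
qed

text \<open>The left side is the form in which the product and quotient rules deliver the second
  derivative of \<open>f\<close>, with \<open>e\<close> the exponential factor, \<open>p\<close> and
  \<open>q\<close> standing for \<open>B1\<close> and \<open>B\<close>, and \<open>2 * z\<close>
  coming from the chain rule. Factoring out the first derivative leaves its logarithmic
  derivative.\<close>

lemma quotient_rule_identity:
  fixes a e z p p' q q' :: complex
  assumes "p \<noteq> 0" "q \<noteq> 0"
  shows "a * (e * (a * (2 * z * q' / q)) * (p / q) + (p' * (2 * z) * q - p * (q' * (2 * z))) / (q * q) * e)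
    = a * (e * (p / q)) * (2 * z * p' / p + (a - 1) * (2 * z * q' / q))"
proof -
  have "(p' * (2 * z) * q - p * (q' * (2 * z))) / (q * q) = (p / q) * (2 * z * p' / p - 2 * z * q' / q)"
    using assms by (simp add: field_simps)
  thus ?thesis by (simp only: ring_distribs mult_1_left) (simp only: algebra_simps)
qed

text \<open>Off a neighbourhood of 0 the principal power need not continue the germ of
  \<open>f\<close>, so \<open>f\<close> is continued as \<open>z * exp (\<alpha> * l z)\<close> with
  a holomorphic logarithm \<open>l\<close> of \<open>E\<close>. Its derivative is
  \<open>\<alpha> * exp (\<alpha> * l z) * B1 / B\<close> at \<open>z^2\<close>, so both
  \<open>B\<close> and \<open>B1\<close> enter the convexity quotient.\<close>

lemma convexity_radius_bessel_f:
  assumes \<beta>: "\<beta> < 1" and \<nu>: "\<nu> > real n"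
  shows "\<exists>\<rho>. convexity_radius \<beta> (bessel_f \<nu> n) = ereal \<rho> \<and>
          smallest_positive_root
            (\<lambda>r. bessel_J_deriv \<nu> (n + 1) (of_real r) \<noteq> 0 \<and>
                 bessel_J_deriv \<nu> n (of_real r) \<noteq> 0 \<and>
                 of_real (1 - \<beta>)
                 + of_real r * bessel_J_deriv \<nu> (n + 2) (of_real r)
                     / bessel_J_deriv \<nu> (n + 1) (of_real r)
                 + of_real (1 / (\<nu> - real n) - 1)
                     * (of_real r * bessel_J_deriv \<nu> (n + 1) (of_real r)
                         / bessel_J_deriv \<nu> n (of_real r)) = 0) \<rho> \<and>
          \<rho> < bessel_zero \<nu> (n + 1) 1 \<and>
          bessel_zero \<nu> (n + 1) 1 < bessel_zero \<nu> n 1"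
    (is "\<exists>\<rho>. _ \<and> smallest_positive_root ?P \<rho> \<and> _")
proof -
  have \<nu>': "\<nu> > -1" "\<nu> > real n - 1" "\<nu> > real (Suc n) - 1" using \<nu> by auto
  define d where "d = \<nu> - real n"
  define \<alpha> where "\<alpha> = 1 / d"
  have d: "d > 0" using \<nu> by (simp add: d_def)
  hence \<alpha>: "\<alpha> > 0" "complex_of_real \<alpha> * of_real d = 1" by (simp_all add: \<alpha>_def)
  define B where "B = bessel_fps \<nu> n"
  define B1 where "B1 = bessel_fps \<nu> (Suc n)"
  have B1_op: "B1 = bessel_op d B" by (simp add: B1_def B_def d_def bessel_fps_Suc_eq_bessel_op)
  have B: "rayleigh_class B" unfolding B_def by (intro rayleigh_class_bessel_fps \<nu>')
  have B1: "rayleigh_class B1" unfolding B1_def by (intro rayleigh_class_bessel_fps \<nu>')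
  have Bc: "fps_conv_radius B = \<infinity>" "fps_nth B 0 \<noteq> 0" and B1c: "fps_conv_radius B1 = \<infinity>" "fps_nth B1 0 \<noteq> 0"
    using B B1 by (auto simp: rayleigh_class_def)
  define S where "S = neg_logderiv B"
  define S1 where "S1 = neg_logderiv B1"
  obtain R where R: "fps_conv_radius S = ereal R" "0 < R"
    using rayleigh_class_radius[OF B] by (metis S_def)
  obtain R1 where R1: "fps_conv_radius S1 = ereal R1" "0 < R1" "eval_fps B1 (of_real R1) = 0"
    using rayleigh_class_radius[OF B1] by (metis S1_def)
  have less: "R1 < R"
    using rayleigh_class_bessel_op_radius_less[OF B d] R(1) R1(1) by (simp add: S_def S1_def B1_op)
  have S: "nonneg_fps S" and S1: "nonneg_fps S1" using B B1 by (auto simp: rayleigh_class_def S_def S1_def)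
  obtain A q where A: "A > 0" "\<And>k. A * q ^ k \<le> Re (fps_nth S k)"
    using B unfolding rayleigh_class_def S_def by blast

  define K where "K = S1 + fps_const (of_real (\<alpha> - 1)) * S"
  have SK: "nonneg_fps (S1 - S)"
    unfolding S_def S1_def B1_op using S d Bc by (intro nonneg_neg_logderiv_bessel_op_diff) (auto simp: S_def)
  \<comment> \<open>For \<open>\<nu> - n > 1\<close> the factor \<open>\<alpha> - 1\<close> is
    negative; this regrouping has only nonnegative summands.\<close>
  have K_eq: "K = (S1 - S) + fps_const (of_real \<alpha>) * S"
    by (simp add: K_def algebra_simps flip: fps_const_sub)
  have K: "nonneg_fps K"
    unfolding K_eq using \<alpha> by (intro nonneg_fps_add nonneg_fps_mult nonneg_fps_const SK S) auto
  have "0 \<le> Re (fps_nth (S1 - S) 0)" by (rule nonneg_fps_Re_nth[OF SK])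
  moreover have "0 < \<alpha> * Re (fps_nth S 0)" using A(1) A(2)[of 0] \<alpha> by simp
  ultimately have K0: "0 < Re (fps_nth K 0)" by (simp add: K_eq)
  \<comment> \<open>Only a lower bound is stated: for \<open>\<alpha> = 1\<close> the product is the
    zero series.\<close>
  have aS: "fps_conv_radius (fps_const (of_real (\<alpha> - 1)) * S) \<ge> ereal R"
    using R by (intro fps_conv_radius_mult_ge) auto
  have "ereal R1 \<le> ereal R" using less by simp
  also note aS
  finally have RK: "ereal R1 \<le> fps_conv_radius K"
    unfolding K_def using R1(1) by (intro fps_conv_radius_add_ge) simp
  have eval_K: "eval_fps K w = eval_fps S1 w + of_real (\<alpha> - 1) * eval_fps S w" if "norm w < R1" for w
  proof -
    have "ereal (norm w) < ereal R" using that less by simp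
    also note aS
    finally show ?thesis
      unfolding K_def using that R R1 less by (simp add: eval_fps_add eval_fps_mult del: of_real_diff)
  qed
  \<comment> \<open>\<open>S1\<close> is unbounded towards \<open>R1\<close>, while \<open>S\<close>
    stays between 0 and its value at \<open>R1\<close>, because \<open>R1 < R\<close>.\<close>
  have unbounded: "\<exists>r. 0 < r \<and> r < R1 \<and> M < Re (eval_fps K (of_real r))" for M
  proof -
    define M0 where "M0 = Re (eval_fps S (of_real R1))"
    obtain r where r: "0 < r" "r < R1" "M + \<bar>\<alpha> - 1\<bar> * M0 < Re (eval_fps S1 (of_real r))"
      using neg_logderiv_unbounded[OF B1, of R1] R1 unfolding S1_def by blast
    have "0 \<le> Re (fps_nth S 0)" by (rule nonneg_fps_Re_nth[OF S])
    also have "\<dots> \<le> Re (eval_fps S (of_real r))"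
      using r R less by (intro nonneg_fps_eval_ge S) auto
    finally have S0: "0 \<le> Re (eval_fps S (of_real r))" .
    have "Re (eval_fps S (of_real r)) \<le> M0"
      unfolding M0_def using r R less by (intro nonneg_fps_eval_mono S) auto
    hence "\<bar>(\<alpha> - 1) * Re (eval_fps S (of_real r))\<bar> \<le> \<bar>\<alpha> - 1\<bar> * M0"
      using S0 unfolding abs_mult by (intro mult_left_mono) auto
    moreover have "Re (eval_fps K (of_real r)) = Re (eval_fps S1 (of_real r)) + (\<alpha> - 1) * Re (eval_fps S (of_real r))"
      using eval_K[of "of_real r"] r by (simp del: of_real_diff)
    ultimately have "M < Re (eval_fps K (of_real r))" using r(3) by linarith
    with r show ?thesis by blast
  qed
  have "(1 - \<beta>) / 2 > 0" using \<beta> by simp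
  then obtain x where x: "0 < x" "x < R1" "x * Re (eval_fps K (of_real x)) = (1 - \<beta>) / 2"
    "\<And>w. norm w < x \<Longrightarrow> Re (w * eval_fps K w) < (1 - \<beta>) / 2"
    using nonneg_fps_level_point[OF K K0 R1(2) RK unbounded] by blast
  have "eval_fps K (of_real x) = of_real (Re (eval_fps K (of_real x)))"
    using K x less_le_trans[OF _ RK] by (intro nonneg_fps_eval_real) auto
  hence xK: "of_real x * eval_fps K (of_real x) = of_real ((1 - \<beta>) / 2)"
    using x(3) by (metis of_real_mult)
  define \<rho> where "\<rho> = sqrt x"
  have \<rho>: "0 < \<rho>" "\<rho> ^ 2 = x" "\<rho> < sqrt R1" using x by (auto simp: \<rho>_def)
  have nz: "eval_fps B w \<noteq> 0" if "norm w < R" for w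
    using that R by (intro eval_nonzero[OF Bc]) (simp add: S_def)
  have nz1: "eval_fps B1 w \<noteq> 0" if "norm w < R1" for w
    using that R1 by (intro eval_nonzero[OF B1c]) (simp add: S1_def)
  have Kw: "2 * w * eval_fps (fps_deriv B1) w / eval_fps B1 w
      + of_real (\<alpha> - 1) * (2 * w * eval_fps (fps_deriv B) w / eval_fps B w) = - 2 * (w * eval_fps K w)"
    if w: "norm w < R1" for w
  proof -
    have "eval_fps S w = - eval_fps (fps_deriv B) w / eval_fps B w"
      using w R less unfolding S_def by (intro eval_neg_logderiv[OF Bc]) simp
    moreover have "eval_fps S1 w = - eval_fps (fps_deriv B1) w / eval_fps B1 w"
      using w R1 unfolding S1_def by (intro eval_neg_logderiv[OF B1c]) simp
    moreover have "2 * w * p1 / q1 + c * (2 * w * p / q) = - 2 * (w * (- p1 / q1 + c * (- p / q)))"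
      for c p q p1 q1 :: complex by (simp add: algebra_simps)
    ultimately show ?thesis unfolding eval_K[OF w] by (simp only:)
  qed
  have sq: "norm (z ^ 2) < R1" if "norm z < sqrt R1" for z :: complex
    using that by (simp add: norm_power power2_less_of_less_sqrt)

  have "convexity_radius \<beta> (bessel_f \<nu> n) = ereal \<rho>"
  proof -
    define \<kappa> where "\<kappa> = complex_of_real (2 powr \<nu> * Gamma (\<nu> - real n + 1))"
    have "Gamma (\<nu> - real n + 1) > 0" using \<nu> by (intro Gamma_real_pos) auto
    hence \<kappa>: "\<kappa> \<noteq> 0" by (simp add: \<kappa>_def)
    define E where "E = (\<lambda>z::complex. \<kappa> * eval_fps B (z ^ 2))"
    have E: "normalized_bessel \<nu> n z = E z" for z
      unfolding normalized_bessel_eq_eval[OF \<nu>'(1,2)] by (simp add: E_def \<kappa>_def B_def)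
    have dB: "((\<lambda>z. eval_fps P (z ^ 2)) has_field_derivative eval_fps (fps_deriv P) (z ^ 2) * (2 * z)) (at z)"
      if "fps_conv_radius P = \<infinity>" for P and z :: complex
      by (rule DERIV_chain2[OF has_field_derivative_eval_fps]) (auto simp: that intro!: derivative_eq_intros)
    have dE: "(E has_field_derivative \<kappa> * (eval_fps (fps_deriv B) (z ^ 2) * (2 * z))) (at z)" for z
      unfolding E_def by (intro DERIV_cmult dB Bc)
    have E_nz: "E z \<noteq> 0" if "z \<in> ball 0 (sqrt R1)" for z
      using nz[of "z ^ 2"] sq[of z] that less \<kappa> by (simp add: E_def)
    have "E holomorphic_on ball 0 (sqrt R1)"
      by (rule holomorphic_onI) (auto simp: field_differentiable_def intro: has_field_derivative_at_within dE)
    then obtain l0 where l0: "l0 holomorphic_on ball 0 (sqrt R1)" "\<And>z. z \<in> ball 0 (sqrt R1) \<Longrightarrow> exp (l0 z) = E z"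
      using holomorphic_logarithm_exists[of "ball 0 (sqrt R1)" E 0] E_nz R1 by auto
    \<comment> \<open>Subtracting \<open>l0 0\<close> selects the branch with
      \<open>l 0 = 0\<close>; it is still a logarithm of \<open>E\<close>, because
      \<open>exp (l0 0) = E 0 = 1\<close>.\<close>
    define l where "l = (\<lambda>z. l0 z - l0 0)"
    have in0: "0 \<in> ball (0::complex) (sqrt R1)" using R1 by simp
    have "E 0 = 1" using normalized_bessel_0[OF \<nu>'(1,2)] E by simp
    hence l: "exp (l z) = E z" if "z \<in> ball 0 (sqrt R1)" for z
      using l0(2)[OF that] l0(2)[OF in0] by (simp add: l_def exp_diff)
    have l_hol: "l holomorphic_on ball 0 (sqrt R1)" unfolding l_def by (intro holomorphic_intros l0)
    have dl: "(l has_field_derivative 2 * z * eval_fps (fps_deriv B) (z ^ 2) / eval_fps B (z ^ 2)) (at z)"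
      if z: "z \<in> ball 0 (sqrt R1)" for z
    proof -
      have D: "(l has_field_derivative deriv l z) (at z)"
        by (rule holomorphic_derivI[OF l_hol open_ball z])
      have "((\<lambda>z. exp (l z)) has_field_derivative exp (l z) * deriv l z) (at z)"
        by (rule DERIV_fun_exp[OF D])
      hence "(E has_field_derivative exp (l z) * deriv l z) (at z)"
        by (rule has_field_derivative_transform_within_open[OF _ open_ball z]) (rule l)
      from DERIV_unique[OF this dE] have "deriv l z = 2 * z * eval_fps (fps_deriv B) (z ^ 2) / eval_fps B (z ^ 2)"
        using l[OF z] E_nz[OF z] \<kappa> by (simp add: E_def field_simps)
      with D show ?thesis by simp
    qed
    show ?thesis
    \<comment> \<open>The second derivative is given as the first one times a bracket, so the first
      cancels in the quotient. On the disc of radius \<open>sqrt R1\<close> neither \<open>B\<close>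
      nor \<open>B1\<close> vanishes at \<open>z^2\<close>.\<close>
    proof (rule convexity_radius_eqI[where C = "sqrt R1" and \<phi> = "\<lambda>z. z * exp (of_real \<alpha> * l z)"
        and \<phi>' = "\<lambda>z. of_real \<alpha> * (exp (of_real \<alpha> * l z) * (eval_fps B1 (z ^ 2) / eval_fps B (z ^ 2)))"
        and \<phi>'' = "\<lambda>z. of_real \<alpha> * (exp (of_real \<alpha> * l z) * (eval_fps B1 (z ^ 2) / eval_fps B (z ^ 2)))
           * (2 * z * eval_fps (fps_deriv B1) (z ^ 2) / eval_fps B1 (z ^ 2)
              + of_real (\<alpha> - 1) * (2 * z * eval_fps (fps_deriv B) (z ^ 2) / eval_fps B (z ^ 2)))"])
      show "0 < \<rho>" "\<rho> < sqrt R1" by fact+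
      have "isCont l 0"
        using dl[OF in0] by (rule DERIV_isCont)
      hence "(l \<longlongrightarrow> l 0) (nhds 0)" by (simp add: isCont_def tendsto_at_iff_tendsto_nhds)
      \<comment> \<open>Where the imaginary part of \<open>l z\<close> is below \<open>pi\<close> in
        absolute value, \<open>l z\<close> is the principal logarithm of \<open>E z\<close>, so the
        power in \<open>bessel_f\<close> agrees with the exponential.\<close>
      hence "\<forall>\<^sub>F z in nhds 0. l z \<in> ball 0 pi"
        by (rule topological_tendstoD) (auto simp: l_def)
      moreover have "\<forall>\<^sub>F z in nhds 0. z \<in> ball (0 :: complex) (sqrt R1)"
        by (rule eventually_nhds_in_open[OF open_ball in0])
      ultimately show "\<forall>\<^sub>F z in nhds 0. bessel_f \<nu> n z = z * exp (of_real \<alpha> * l z)"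
      proof eventually_elim
        case (elim z)
        have "\<bar>Im (l z)\<bar> < pi" using elim(1) abs_Im_le_cmod[of "l z"] by simp
        hence "Ln (exp (l z)) = l z" by (intro Ln_exp) auto
        hence "E z powr of_real \<alpha> = exp (of_real \<alpha> * l z)"
          using E_nz[OF elim(2)] l[OF elim(2)] by (simp add: powr_def)
        thus ?case unfolding bessel_f_def E by (simp add: \<alpha>_def d_def)
      qed
    next
      fix z :: complex assume "norm z < sqrt R1"
      hence z: "z \<in> ball 0 (sqrt R1)" by simp
      have b: "eval_fps B (z ^ 2) \<noteq> 0" "eval_fps B1 (z ^ 2) \<noteq> 0"
        using nz[of "z ^ 2"] nz1[of "z ^ 2"] sq[of z] z less by auto
      define e where "e = exp (of_real \<alpha> * l z)"
      have de: "((\<lambda>z. exp (of_real \<alpha> * l z)) has_field_derivative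
          e * (of_real \<alpha> * (2 * z * eval_fps (fps_deriv B) (z ^ 2) / eval_fps B (z ^ 2)))) (at z)"
        unfolding e_def by (intro DERIV_fun_exp DERIV_cmult dl z)
      \<comment> \<open>Writing \<open>e\<close> as \<open>\<alpha> * d * e\<close> produces the
        term \<open>d * B\<close> that completes \<open>2 * w * B'\<close> to
        \<open>B1\<close>.\<close>
      have "e + e * (of_real \<alpha> * (2 * z * eval_fps (fps_deriv B) (z ^ 2) / eval_fps B (z ^ 2))) * z
          = of_real \<alpha> * of_real d * e + e * (of_real \<alpha> * (2 * z * eval_fps (fps_deriv B) (z ^ 2) / eval_fps B (z ^ 2))) * z"
        unfolding \<alpha>(2) by simp
      also have "\<dots> = of_real \<alpha> * (e * (eval_fps B1 (z ^ 2) / eval_fps B (z ^ 2)))"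
      proof -
        have "a * c * e + e * (a * (2 * z * p' / p)) * z = a * (e * ((c * p + 2 * z ^ 2 * p') / p))"
          if "p \<noteq> 0" for a c p p' :: complex
          using that by (simp add: field_simps power2_eq_square)
        from this[OF b(1)] show ?thesis unfolding B1_op eval_bessel_op[OF Bc(1)] .
      qed
      finally show "((\<lambda>z. z * exp (of_real \<alpha> * l z)) has_field_derivative
          of_real \<alpha> * (exp (of_real \<alpha> * l z) * (eval_fps B1 (z ^ 2) / eval_fps B (z ^ 2)))) (at z)"
        using DERIV_mult[OF DERIV_ident de] by (simp add: e_def)
      have "of_real \<alpha> * (e * (of_real \<alpha> * (2 * z * eval_fps (fps_deriv B) (z ^ 2) / eval_fps B (z ^ 2))) * (eval_fps B1 (z ^ 2) / eval_fps B (z ^ 2))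
          + (eval_fps (fps_deriv B1) (z ^ 2) * (2 * z) * eval_fps B (z ^ 2) - eval_fps B1 (z ^ 2) * (eval_fps (fps_deriv B) (z ^ 2) * (2 * z)))
            / (eval_fps B (z ^ 2) * eval_fps B (z ^ 2)) * e)
        = of_real \<alpha> * (e * (eval_fps B1 (z ^ 2) / eval_fps B (z ^ 2)))
           * (2 * z * eval_fps (fps_deriv B1) (z ^ 2) / eval_fps B1 (z ^ 2)
              + of_real (\<alpha> - 1) * (2 * z * eval_fps (fps_deriv B) (z ^ 2) / eval_fps B (z ^ 2)))"
        using quotient_rule_identity[OF b(2,1), of "of_real \<alpha>" e z] by simp
      with DERIV_cmult[OF DERIV_mult[OF de DERIV_divide[OF dB[OF B1c(1)] dB[OF Bc(1)] b(1)]], of "of_real \<alpha>"]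
      show "((\<lambda>z. of_real \<alpha> * (exp (of_real \<alpha> * l z) * (eval_fps B1 (z ^ 2) / eval_fps B (z ^ 2)))) has_field_derivative
           of_real \<alpha> * (exp (of_real \<alpha> * l z) * (eval_fps B1 (z ^ 2) / eval_fps B (z ^ 2)))
           * (2 * z * eval_fps (fps_deriv B1) (z ^ 2) / eval_fps B1 (z ^ 2)
              + of_real (\<alpha> - 1) * (2 * z * eval_fps (fps_deriv B) (z ^ 2) / eval_fps B (z ^ 2)))) (at z)"
        by (simp only: e_def)
    next
      let ?\<phi>' = "\<lambda>z. of_real \<alpha> * (exp (of_real \<alpha> * l z) * (eval_fps B1 (z ^ 2) / eval_fps B (z ^ 2)))"
      let ?H = "\<lambda>z. 2 * z * eval_fps (fps_deriv B1) (z ^ 2) / eval_fps B1 (z ^ 2)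
              + of_real (\<alpha> - 1) * (2 * z * eval_fps (fps_deriv B) (z ^ 2) / eval_fps B (z ^ 2))"
      have nz\<phi>: "?\<phi>' z \<noteq> 0" if "norm z < sqrt R1" for z
        using nz[of "z ^ 2"] nz1[of "z ^ 2"] sq[OF that] \<alpha> less by simp
      have *: "1 + z * (?\<phi>' z * ?H z) / ?\<phi>' z = 1 - 2 * (z ^ 2 * eval_fps K (z ^ 2))"
        if "norm z < sqrt R1" for z
      proof -
        have "u * (v * t) / v = u * t" if "v \<noteq> 0" for u v t :: complex using that by simp
        from this[OF nz\<phi>[OF that]] have "z * (?\<phi>' z * ?H z) / ?\<phi>' z = z * ?H z" .
        also have "\<dots> = - 2 * (z ^ 2 * eval_fps K (z ^ 2))"
          unfolding Kw[OF sq[OF that], symmetric] by (simp add: algebra_simps power2_eq_square)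
        finally show ?thesis by simp
      qed
      show "Re (1 + of_real \<rho> * (?\<phi>' (of_real \<rho>) * ?H (of_real \<rho>)) / ?\<phi>' (of_real \<rho>)) \<le> \<beta>"
        using \<rho> by (subst *) (simp_all add: xK diff_divide_distrib flip: of_real_power)
      fix z :: complex assume z: "norm z < \<rho>"
      hence z': "norm z < sqrt R1" using \<rho> by simp
      show "?\<phi>' z \<noteq> 0" by (rule nz\<phi>[OF z'])
      have "norm (z ^ 2) < x"
        using z \<rho> by (metis norm_ge_zero norm_power power_strict_mono zero_less_numeral)
      from x(4)[OF this] show "\<beta> < Re (1 + z * (?\<phi>' z * ?H z) / ?\<phi>' z)"
        by (subst *[OF z']) (simp add: field_simps)
    qed
  qed
  moreover have "smallest_positive_root ?P \<rho>"
  proof (rule smallest_positive_root_levelI[where G = "\<lambda>r. of_real (r ^ 2) * eval_fps K (of_real (r ^ 2))"])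
    show "0 < \<rho>" by fact
    show "of_real (\<rho> ^ 2) * eval_fps K (of_real (\<rho> ^ 2)) = of_real ((1 - \<beta>) / 2)"
      using \<rho> xK by simp
  next
    fix r assume r: "0 < r" "r < \<rho>"
    have "norm (complex_of_real (r ^ 2)) < x"
      using r \<rho> by (simp add: norm_power power_strict_mono flip: \<rho>(2))
    thus "Re (of_real (r ^ 2) * eval_fps K (of_real (r ^ 2))) < (1 - \<beta>) / 2" by (rule x(4))
  next
    fix r assume r: "0 < r" "r \<le> \<rho>"
    define w where "w = complex_of_real (r ^ 2)"
    have "norm w \<le> x"
      using r \<rho> by (simp add: w_def norm_power power_mono flip: \<rho>(2))
    hence w: "norm w < R1" using x by simp
    have b: "eval_fps B w \<noteq> 0" "eval_fps B1 w \<noteq> 0" using nz nz1 w less by auto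
    have J: "bessel_J_deriv \<nu> n (of_real r) \<noteq> 0" "bessel_J_deriv \<nu> (n + 1) (of_real r) \<noteq> 0"
      using b bessel_J_deriv_eq_0_iff[OF \<nu>'(1) r(1)] by (auto simp: B_def B1_def w_def)
    have q1: "of_real r * bessel_J_deriv \<nu> (n + 2) (of_real r) / bessel_J_deriv \<nu> (n + 1) (of_real r)
        = of_real (d - 1) + 2 * w * eval_fps (fps_deriv B1) w / eval_fps B1 w"
      using bessel_J_logderiv[OF \<nu>'(1) r(1), of "Suc n"] b(2) by (simp add: B1_def w_def d_def algebra_simps)
    have q: "of_real r * bessel_J_deriv \<nu> (n + 1) (of_real r) / bessel_J_deriv \<nu> n (of_real r)
        = of_real d + 2 * w * eval_fps (fps_deriv B) w / eval_fps B w"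
      using bessel_J_logderiv[OF \<nu>'(1) r(1), of n] b(1) by (simp add: B_def w_def d_def)
    have "?P r \<longleftrightarrow> of_real (1 - \<beta>) + (of_real (d - 1) + 2 * w * eval_fps (fps_deriv B1) w / eval_fps B1 w)
        + of_real (\<alpha> - 1) * (of_real d + 2 * w * eval_fps (fps_deriv B) w / eval_fps B w) = 0"
      using J unfolding q q1 \<alpha>_def d_def by (simp only: simp_thms)
    \<comment> \<open>The constants \<open>d - 1\<close> and \<open>(\<alpha> - 1) * d\<close> add
      up to \<open>\<alpha> * d - 1 = 0\<close>.\<close>
    also have "of_real (1 - \<beta>) + (of_real (d - 1) + 2 * w * eval_fps (fps_deriv B1) w / eval_fps B1 w)
        + of_real (\<alpha> - 1) * (of_real d + 2 * w * eval_fps (fps_deriv B) w / eval_fps B w)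
      = of_real (1 - \<beta>) + (of_real \<alpha> * of_real d - 1) + (2 * w * eval_fps (fps_deriv B1) w / eval_fps B1 w
      + of_real (\<alpha> - 1) * (2 * w * eval_fps (fps_deriv B) w / eval_fps B w))"
      by (simp add: algebra_simps)
    also have "\<dots> = of_real (1 - \<beta>) - 2 * (w * eval_fps K w)"
      unfolding Kw[OF w] \<alpha>(2) by simp
    also have "\<dots> = 0 \<longleftrightarrow> w * eval_fps K w = complex_of_real ((1 - \<beta>) / 2)"
      by (auto simp: field_simps)
    finally show "?P r \<longleftrightarrow> of_real (r ^ 2) * eval_fps K (of_real (r ^ 2)) = complex_of_real ((1 - \<beta>) / 2)"
      unfolding w_def .
  qed
  moreover have "bessel_zero \<nu> (n + 1) 1 = sqrt R1"
    using bessel_zero_first_eq_radius[OF \<nu>'(1,3)] R1(1) by (simp add: S1_def B1_def)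
  moreover have "bessel_zero \<nu> n 1 = sqrt R"
    using bessel_zero_first_eq_radius[OF \<nu>'(1,2)] R(1) by (simp add: S_def B_def)
  ultimately show ?thesis using \<rho>(3) less by (intro exI[of _ \<rho>]) simp
qed

theorem theorem3p2:
  fixes n :: nat and \<nu> \<beta> :: real
  assumes "0 \<le> \<beta>" and "\<beta> < 1"
  shows
    "(\<nu> > real n \<longrightarrow>
       (\<exists>\<rho>. convexity_radius \<beta> (bessel_f \<nu> n) = ereal \<rho> \<and>
          smallest_positive_root
            (\<lambda>r. bessel_J_deriv \<nu> (n + 1) (of_real r) \<noteq> 0 \<and>
                 bessel_J_deriv \<nu> n (of_real r) \<noteq> 0 \<and>
                 of_real (1 - \<beta>)
                 + of_real r * bessel_J_deriv \<nu> (n + 2) (of_real r)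
                     / bessel_J_deriv \<nu> (n + 1) (of_real r)
                 + of_real (1 / (\<nu> - real n) - 1)
                     * (of_real r * bessel_J_deriv \<nu> (n + 1) (of_real r)
                         / bessel_J_deriv \<nu> n (of_real r)) = 0) \<rho> \<and>
          \<rho> < bessel_zero \<nu> (n + 1) 1 \<and>
          bessel_zero \<nu> (n + 1) 1 < bessel_zero \<nu> n 1))
     \<and>
     (\<nu> > real n - 1 \<longrightarrow>
       (\<exists>\<rho>. convexity_radius \<beta> (bessel_g \<nu> n) = ereal \<rho> \<and>
          smallest_positive_root
            (\<lambda>r. of_real (real n - \<nu> + 1) * bessel_J_deriv \<nu> n (of_real r)
                   + of_real r * bessel_J_deriv \<nu> (n + 1) (of_real r) \<noteq> 0 \<and>
                 of_real (real n + 1 - \<nu> - \<beta>)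
                 + (of_real (real n - \<nu> + 2) * of_real r * bessel_J_deriv \<nu> (n + 1) (of_real r)
                     + of_real r ^ 2 * bessel_J_deriv \<nu> (n + 2) (of_real r))
                   / (of_real (real n - \<nu> + 1) * bessel_J_deriv \<nu> n (of_real r)
                     + of_real r * bessel_J_deriv \<nu> (n + 1) (of_real r)) = 0) \<rho>))
     \<and>
     (\<nu> > real n - 1 \<longrightarrow>
       (\<exists>\<rho>. convexity_radius \<beta> (bessel_h \<nu> n) = ereal \<rho> \<and>
          smallest_positive_root
            (\<lambda>r. of_real (real n - \<nu> + 2) * bessel_J_deriv \<nu> n (of_real (sqrt r))
                   + of_real (sqrt r) * bessel_J_deriv \<nu> (n + 1) (of_real (sqrt r)) \<noteq> 0 \<and>
                 of_real ((real n + 2 - \<nu> - 2 * \<beta>) / 2)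
                 + of_real (sqrt r) / 2
                   * ((of_real (real n - \<nu> + 3) * bessel_J_deriv \<nu> (n + 1) (of_real (sqrt r))
                        + of_real (sqrt r) * bessel_J_deriv \<nu> (n + 2) (of_real (sqrt r)))
                      / (of_real (real n - \<nu> + 2) * bessel_J_deriv \<nu> n (of_real (sqrt r))
                        + of_real (sqrt r) * bessel_J_deriv \<nu> (n + 1) (of_real (sqrt r)))) = 0) \<rho>))"
  using assms(2)
  by (intro conjI impI convexity_radius_bessel_f convexity_radius_bessel_g convexity_radius_bessel_h) auto

end
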